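(* Let $\Bbbk$ be an algebraically closed field and let $I$ be a left ideal of $M_n(\Bbbk[x_1,\ldots,x_d])$. Then its radical $\sqrt{I}$ is equal to each of the following: (1) the set of all $F \in M_n(\Bbbk[x_1,\ldots,x_d])$ such that for every $A \in M_n(\Bbbk)$ there is $N \in \mathbb{N}_0$ satisfying $(AF)^N \in I+I(AF)+\ldots+I(AF)^N$; (2) the intersection of all completely prime left ideals of $M_n(\Bbbk[x_1,\ldots,x_d])$ that contain $I$; (3) the intersection of all prime left ideals of $M_n(\Bbbk[x_1,\ldots,x_d])$ that contain $I$; (4) the smallest semiprime left ideal of $M_n(\Bbbk[x_1,\ldots,x_d])$ that contains $I$.
   Context: $\Bbbk[x_1,\ldots,x_d]$ is the usual commutative polynomial ring and $M_n(\Bbbk[x_1,\ldots,x_d])$ the ring of $n\times n$ matrix polynomials. A directional point is a pair $(a,v)$ with $a\in\Bbbk^d$ and $v\in\Bbbk^n$ nonzero; the value of a matrix polynomial $F$ at $(a,v)$ is $F(a)v\in\Bbbk^n$, and $F$ annihilates $(a,v)$ if $F(a)v=0$. For a left ideal $I$ of $M_n(\Bbbk[x_1,\ldots,x_d])$, the radical $\sqrt{I}$ is the set of all $F\in M_n(\Bbbk[x_1,\ldots,x_d])$ which annihilate all directional points that are annihilated by all elements of $I$. For a left ideal $I$ of an associative unital ring $A$: $I$ is prime if for all $a,b\in A$ with $aAb\subseteq I$ we have $a\in I$ or $b\in I$; $I$ is semiprime if for every $a\in A$ with $aAa\subseteq I$ we have $a\in I$; $I$ is completely prime if for all $a,b\in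 A$ with $ab\in I$ and $Ib\subseteq I$ we have $a\in I$ or $b\in I$. For $F\in A$, $IF^k=\{GF^k\mid G\in I\}$. *)

theory Defs
  imports
    "HOL-Analysis.Finite_Cartesian_Product"
    "HOL-Computational_Algebra.Polynomial"
    "HOL-Library.Poly_Mapping"
    "HOL-Algebra.Ideal"
begin

section \<open>One-sided ideals of associative unital rings\<close>

locale left_ideal = additive_subgroup I R + ring R for I and R (structure) +
  assumes I_l_closed: "\<lbrakk>a \<in> I; x \<in> carrier R\<rbrakk> \<Longrightarrow> x \<otimes> a \<in> I"

text \<open>As opposed to \<^locale>\<open>primeideal\<close>, none of the following three notions
  requires the left ideal to be proper.\<close>

locale prime_left_ideal = left_ideal +
  assumes prime: "\<lbrakk>a \<in> carrier R; b \<in> carrier R; \<And>x. x \<in> carrier R \<Longrightarrow> a \<otimes> x \<otimes> b \<in> I\<rbrakk>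
    \<Longrightarrow> a \<in> I \<or> b \<in> I"

locale semiprime_left_ideal = left_ideal +
  assumes semiprime: "\<lbrakk>a \<in> carrier R; \<And>x. x \<in> carrier R \<Longrightarrow> a \<otimes> x \<otimes> a \<in> I\<rbrakk> \<Longrightarrow> a \<in> I"

locale completely_prime_left_ideal = left_ideal +
  assumes completely_prime:
    "\<lbrakk>a \<in> carrier R; b \<in> carrier R; a \<otimes> b \<in> I; \<And>g. g \<in> I \<Longrightarrow> g \<otimes> b \<in> I\<rbrakk> \<Longrightarrow> a \<in> I \<or> b \<in> I"

text \<open>The additive subset \<open>I + I b + \<dots> + I b\<^sup>N\<close>.\<close>

definition right_powers_sum :: "('r, 'm) ring_scheme \<Rightarrow> 'r set \<Rightarrow> 'r \<Rightarrow> nat \<Rightarrow> 'r set" where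
  "right_powers_sum R I b N =
     {\<Oplus>\<^bsub>R\<^esub>k\<in>{..N}. g k \<otimes>\<^bsub>R\<^esub> (b [^]\<^bsub>R\<^esub> k) | g. \<forall>k\<le>N. g k \<in> I}"


section \<open>Matrix polynomials\<close>

text \<open>The polynomial ring over \<open>'k\<close> in the \<open>CARD('d)\<close> commuting variables indexed by \<open>'d\<close>:
  finitely supported maps from exponent vectors to coefficients, multiplied by convolution.\<close>

type_synonym ('k, 'd) mpoly = "('d \<Rightarrow>\<^sub>0 nat) \<Rightarrow>\<^sub>0 'k"

definition mpoly_const :: "'k \<Rightarrow> ('k::zero, 'd) mpoly" where
  "mpoly_const c = Poly_Mapping.single 0 c"

definition mpoly_eval :: "'k^'d \<Rightarrow> ('k::comm_semiring_1, 'd::finite) mpoly \<Rightarrow> 'k" where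
  "mpoly_eval a p = (\<Sum>m\<in>Poly_Mapping.keys p.
     Poly_Mapping.lookup p m * (\<Prod>i\<in>UNIV. (a $ i) ^ Poly_Mapping.lookup m i))"

type_synonym ('k, 'd, 'n) matrix_poly = "(('k, 'd) mpoly)^'n^'n"

text \<open>The type class multiplication on vectors is entrywise, so matrices with their usual
  product are packaged as an explicit ring structure.\<close>

definition matrix_ring :: "('r::comm_ring_1^'n^'n) ring" where
  "matrix_ring = \<lparr>carrier = UNIV, mult = (**), one = mat 1, zero = 0, add = (+)\<rparr>"

lemma matrix_ring_simps [simp]:
  "carrier matrix_ring = UNIV"
  "A \<otimes>\<^bsub>matrix_ring\<^esub> B = A ** B"
  "\<one>\<^bsub>matrix_ring\<^esub> = mat 1"
  "\<zero>\<^bsub>matrix_ring\<^esub> = 0"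
  "A \<oplus>\<^bsub>matrix_ring\<^esub> B = A + B"
  by (simp_all add: matrix_ring_def)

lemma ring_matrix_ring: "ring (matrix_ring :: ('r::comm_ring_1^'n^'n) ring)"
proof (rule ringI)
  show "abelian_group (matrix_ring :: ('r^'n^'n) ring)"
    by (rule abelian_groupI) (auto simp: add.assoc add.commute intro: exI [of _ "- _"])
  show "monoid (matrix_ring :: ('r^'n^'n) ring)"
    by (rule monoidI) (auto simp: matrix_mul_assoc)
qed (auto simp: matrix_add_ldistrib matrix_matrix_mult_def vec_eq_iff sum.distrib ring_distribs)

definition annihilates ::
  "('k::field, 'd::finite, 'n::finite) matrix_poly \<Rightarrow> 'k^'d \<Rightarrow> 'k^'n \<Rightarrow> bool" where
  "annihilates F a v \<longleftrightarrow> map_matrix (mpoly_eval a) F *v v = 0"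

definition directional_radical ::
  "('k::field, 'd::finite, 'n::finite) matrix_poly set \<Rightarrow> ('k, 'd, 'n) matrix_poly set" where
  "directional_radical I =
     {F. \<forall>a v. v \<noteq> 0 \<and> (\<forall>G\<in>I. annihilates G a v) \<longrightarrow> annihilates F a v}"

end

theory Submission
  imports Defs
begin

text \<open>
  Let \<open>R\<close> be the polynomial ring. A left ideal \<open>J\<close> of the matrix ring over \<open>R\<close> is determined by the
  submodule \<open>M\<close> of \<open>R\<^sup>n\<close> formed by the rows of its elements. In these terms \<open>J\<close> is semiprime iff
  \<open>f\<^sub>i f \<in> M\<close> for all \<open>i\<close> implies \<open>f \<in> M\<close>, and \<open>J\<close> annihilates a directional point \<open>(a, v)\<close> iff every
  \<open>g \<in> M\<close> satisfies \<open>g(a) \<cdot> v = 0\<close>.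

  The heart of the matter is that a semiprime \<open>J\<close> contains its directional radical
  (\<open>semiprime_submodule_nullstellensatz\<close>). Suppose that \<open>f\<close> vanishes at all directional points at
  which \<open>M\<close> vanishes, but \<open>f \<notin> M\<close>. Choose a prime \<open>P\<close> that is minimal over the ideal
  \<open>b = {r. r f \<in> M}\<close>. If no multiple \<open>u f\<close> with \<open>u \<notin> P\<close> lay in \<open>M + P R\<^sup>n\<close>, then linear algebra over the
  fraction field of \<open>R/P\<close> would give a functional \<open>\<psi>\<close> on \<open>R\<^sup>n\<close> that maps \<open>M\<close>, but not \<open>f\<close>, into \<open>P\<close>
  (\<open>separating_functional\<close>); by Hilbert's Nullstellensatz \<open>P\<close> has a zero \<open>a\<close> with \<open>\<psi>(f)(a) \<noteq> 0\<close>, and \<open>(a, \<psi>(a))\<close>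
  would be a point at which \<open>M\<close> vanishes and \<open>f\<close> does not. Hence \<open>u f = m + e\<close> with \<open>u \<notin> P\<close>, \<open>m \<in> M\<close> and all
  \<open>e\<^sub>i \<in> P\<close>. By minimality of \<open>P\<close>, up to factors outside \<open>P\<close>, some power of each \<open>e\<^sub>i\<close> lies in \<open>b\<close>; it
  multiplies \<open>f\<close>, hence also \<open>e = u f - m\<close>, into \<open>M\<close>. As \<open>M\<close> is semiprime, \<open>t e \<in> M\<close> for some \<open>t \<notin> P\<close>, whence
  \<open>t u \<in> b \<subseteq> P\<close>, which is absurd.

  The descriptions of the radical by ideals follow. The matrix polynomials that annihilate one
  directional point form a left ideal that is both prime and completely prime, and the radical is an
  intersection of such ideals. Completely prime left ideals of matrix rings are prime, prime ones are
  semiprime, and semiprime ones that contain \<open>I\<close> contain the radical.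

  For the description by powers, let \<open>B = A F\<close> with \<open>F\<close> in the radical. If no \<open>B\<^sup>N\<close> lay in
  \<open>I + I B + \<dots> + I B\<^sup>N\<close>, then there would be a prime left ideal that contains \<open>I\<close> but not \<open>B\<close>
  (\<open>exists_prime_left_ideal_avoiding\<close>), contrary to what precedes. Conversely, if \<open>I\<close> annihilates
  \<open>(a, v)\<close> but \<open>F\<close> does not, a constant matrix \<open>A\<close> with \<open>A F(a) v = v\<close> violates the condition: at \<open>(a, v)\<close>
  the powers of \<open>A F\<close> take the value \<open>v \<noteq> 0\<close>, while all elements of \<open>I + I A F + \<dots>\<close> take the value \<open>0\<close>.
\<close>


section \<open>Evaluation of polynomials\<close>

lemma sum_single_keys: "(\<Sum>m\<in>Poly_Mapping.keys p. Poly_Mapping.single m (Poly_Mapping.lookup p m)) = p"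
proof (rule poly_mapping_eqI)
  fix k
  show "Poly_Mapping.lookup (\<Sum>m\<in>Poly_Mapping.keys p. Poly_Mapping.single m (Poly_Mapping.lookup p m)) k
      = Poly_Mapping.lookup p k"
    by (simp add: lookup_sum lookup_single when_def in_keys_iff)
qed

text \<open>Sums over the keys of two polynomials are compared over a common finite set of exponents.\<close>

lemma mpoly_eval_superset:
  assumes "finite K" "Poly_Mapping.keys p \<subseteq> K"
  shows "mpoly_eval a p = (\<Sum>m\<in>K. Poly_Mapping.lookup p m * (\<Prod>i\<in>UNIV. (a $ i) ^ Poly_Mapping.lookup m i))"
  unfolding mpoly_eval_def using assms
  by (intro sum.mono_neutral_left) (auto simp: in_keys_iff)

lemma mpoly_eval_0 [simp]: "mpoly_eval a 0 = 0"
  by (simp add: mpoly_eval_def)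

lemma mpoly_eval_single:
  "mpoly_eval a (Poly_Mapping.single m c) = c * (\<Prod>i\<in>UNIV. (a $ i) ^ Poly_Mapping.lookup m i)"
  by (subst mpoly_eval_superset[of "{m}"]) auto

lemma mpoly_eval_add [simp]: "mpoly_eval a (p + q) = mpoly_eval a p + mpoly_eval a q"
  using keys_add[of p q]
  by (simp add: mpoly_eval_superset[of "Poly_Mapping.keys p \<union> Poly_Mapping.keys q"]
      lookup_add distrib_right sum.distrib)

lemma mpoly_eval_sum [simp]: "mpoly_eval a (sum f A) = (\<Sum>x\<in>A. mpoly_eval a (f x))"
  by (induction A rule: infinite_finite_induct) auto

lemma mpoly_eval_const [simp]: "mpoly_eval a (mpoly_const c) = c"
  by (simp add: mpoly_const_def mpoly_eval_single)

lemma mpoly_const_1 [simp]: "mpoly_const 1 = 1"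
  by (simp add: mpoly_const_def)

lemma mpoly_const_0 [simp]: "mpoly_const 0 = 0"
  by (simp add: mpoly_const_def)

lemma mpoly_eval_1 [simp]: "mpoly_eval a 1 = 1"
  using mpoly_eval_const[of a 1] by simp

lemma mpoly_eval_mult [simp]:
  fixes p q :: "('k::comm_semiring_1, 'd::finite) mpoly"
  shows "mpoly_eval a (p * q) = mpoly_eval a p * mpoly_eval a q"
proof -
  have single: "mpoly_eval a (Poly_Mapping.single m c * Poly_Mapping.single m' c')
      = mpoly_eval a (Poly_Mapping.single m c) * mpoly_eval a (Poly_Mapping.single m' c')"
    for m m' :: "'d \<Rightarrow>\<^sub>0 nat" and c c'
    by (simp add: mult_single mpoly_eval_single lookup_add power_add prod.distrib mult_ac)
  have "mpoly_eval a (sum f A * sum g B) = mpoly_eval a (sum f A) * mpoly_eval a (sum g B)"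
    if "\<And>m m'. mpoly_eval a (f m * g m') = mpoly_eval a (f m) * mpoly_eval a (g m')"
    for f g :: "('d \<Rightarrow>\<^sub>0 nat) \<Rightarrow> ('k, 'd) mpoly" and A B
    by (simp only: sum_product mpoly_eval_sum that)
  from this[of "\<lambda>m. Poly_Mapping.single m (Poly_Mapping.lookup p m)"
      "\<lambda>m. Poly_Mapping.single m (Poly_Mapping.lookup q m)" "Poly_Mapping.keys p" "Poly_Mapping.keys q",
      OF single]
  show ?thesis
    by (simp only: sum_single_keys)
qed

lemma mpoly_eval_uminus [simp]:
  fixes p :: "('k::comm_ring_1, 'd::finite) mpoly"
  shows "mpoly_eval a (- p) = - mpoly_eval a p"
  using mpoly_eval_add[of a p "- p"] by (simp add: eq_neg_iff_add_eq_0 add.commute)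

lemma mpoly_eval_diff [simp]:
  fixes p :: "('k::comm_ring_1, 'd::finite) mpoly"
  shows "mpoly_eval a (p - q) = mpoly_eval a p - mpoly_eval a q"
  using mpoly_eval_add[of a p "- q"] by simp

lemma mpoly_eval_power [simp]: "mpoly_eval a (p ^ n) = mpoly_eval a p ^ n"
  by (induction n) auto


section \<open>Prime ideals and subrings of a commutative ring\<close>

locale prime_ideal =
  fixes P :: "'a::comm_ring_1 set"
  assumes zero_in: "0 \<in> P"
    and add_in: "x \<in> P \<Longrightarrow> y \<in> P \<Longrightarrow> x + y \<in> P"
    and mult_in: "x \<in> P \<Longrightarrow> r * x \<in> P"
    and one_notin: "1 \<notin> P"
    and prime: "x * y \<in> P \<Longrightarrow> x \<in> P \<or> y \<in> P"
begin

lemma mult_in': "x \<in> P \<Longrightarrow> x * r \<in> P"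
  using mult_in[of x r] by (simp add: mult.commute)

lemma uminus_in: "x \<in> P \<Longrightarrow> - x \<in> P"
  using mult_in[of x "- 1"] by simp

lemma diff_in: "x \<in> P \<Longrightarrow> y \<in> P \<Longrightarrow> x - y \<in> P"
  using add_in[of x "- y"] uminus_in[of y] by simp

lemma in_if_diff_in: "x - y \<in> P \<Longrightarrow> y \<in> P \<Longrightarrow> x \<in> P"
  using add_in[of "x - y" y] by simp

lemma sum_in: "(\<And>i. i \<in> A \<Longrightarrow> f i \<in> P) \<Longrightarrow> sum f A \<in> P"
  by (induction A rule: infinite_finite_induct) (auto simp: zero_in add_in)

lemma mult_notin: "x \<notin> P \<Longrightarrow> y \<notin> P \<Longrightarrow> x * y \<notin> P"
  using prime by blast

lemma power_notin: "x \<notin> P \<Longrightarrow> x ^ n \<notin> P"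
  by (induction n) (auto simp: one_notin mult_notin)

lemma prod_notin: "(\<And>i. i \<in> A \<Longrightarrow> f i \<notin> P) \<Longrightarrow> prod f A \<notin> P"
  by (induction A rule: infinite_finite_induct) (auto simp: one_notin mult_notin)

lemma poly_in: "(\<And>i. coeff q i \<in> P) \<Longrightarrow> poly q x \<in> P"
  by (auto simp: poly_altdef intro!: sum_in mult_in')

end

text \<open>The Nullstellensatz is proved for the subrings generated by some of the variables, one variable at a
  time. Since \<open>P\<close> remains an ideal of the whole ring, the primes of the subrings are its traces
  \<open>P \<inter> S\<close>, and a polynomial with coefficients in \<open>S\<close> vanishes modulo the trace iff \<open>coeffs_in P\<close> holds.\<close>

locale subring_of =
  fixes S :: "'a::comm_ring_1 set"
  assumes one_in: "1 \<in> S"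
    and diff_in: "x \<in> S \<Longrightarrow> y \<in> S \<Longrightarrow> x - y \<in> S"
    and mult_in: "x \<in> S \<Longrightarrow> y \<in> S \<Longrightarrow> x * y \<in> S"
begin

lemma zero_in: "0 \<in> S"
  using diff_in[OF one_in one_in] by simp

lemma add_in: "x \<in> S \<Longrightarrow> y \<in> S \<Longrightarrow> x + y \<in> S"
  using diff_in[of x "0 - y"] diff_in[of 0 y] zero_in by simp

lemma sum_in: "(\<And>i. i \<in> A \<Longrightarrow> f i \<in> S) \<Longrightarrow> sum f A \<in> S"
  by (induction A rule: infinite_finite_induct) (auto simp: zero_in add_in)

lemma power_in: "x \<in> S \<Longrightarrow> x ^ n \<in> S"
  by (induction n) (auto simp: one_in mult_in)

lemma prod_in: "(\<And>i. i \<in> A \<Longrightarrow> f i \<in> S) \<Longrightarrow> prod f A \<in> S"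
  by (induction A rule: infinite_finite_induct) (auto simp: one_in mult_in)

end

definition coeffs_in :: "'a::zero set \<Rightarrow> 'a poly \<Rightarrow> bool" where
  "coeffs_in S q \<longleftrightarrow> (\<forall>i. coeff q i \<in> S)"

definition adjoin :: "'a::comm_ring_1 set \<Rightarrow> 'a \<Rightarrow> 'a set" where
  "adjoin S x = {poly q x | q. coeffs_in S q}"

context subring_of
begin

lemma coeffs_in_0: "coeffs_in S 0"
  by (simp add: coeffs_in_def zero_in)

lemma coeffs_in_add: "coeffs_in S p \<Longrightarrow> coeffs_in S q \<Longrightarrow> coeffs_in S (p + q)"
  by (simp add: coeffs_in_def add_in)

lemma coeffs_in_diff: "coeffs_in S p \<Longrightarrow> coeffs_in S q \<Longrightarrow> coeffs_in S (p - q)"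
  by (simp add: coeffs_in_def diff_in)

lemma coeffs_in_mult: "coeffs_in S p \<Longrightarrow> coeffs_in S q \<Longrightarrow> coeffs_in S (p * q)"
  by (simp add: coeffs_in_def coeff_mult sum_in mult_in)

lemma coeffs_in_smult: "c \<in> S \<Longrightarrow> coeffs_in S q \<Longrightarrow> coeffs_in S (smult c q)"
  by (simp add: coeffs_in_def mult_in)

lemma coeffs_in_monom: "c \<in> S \<Longrightarrow> coeffs_in S (monom c n)"
  by (simp add: coeffs_in_def zero_in)

lemma coeffs_in_poly_cutoff: "coeffs_in S q \<Longrightarrow> coeffs_in S (poly_cutoff n q)"
  by (simp add: coeffs_in_def coeff_poly_cutoff zero_in)

lemma adjoin_superset: "S \<subseteq> adjoin S x"
proof
  fix c assume "c \<in> S"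
  then have "coeffs_in S (monom c 0)" by (rule coeffs_in_monom)
  then show "c \<in> adjoin S x"
    unfolding adjoin_def by (intro CollectI exI[of _ "monom c 0"]) (simp add: poly_monom)
qed

lemma adjoin_generator: "x \<in> adjoin S x"
  unfolding adjoin_def using coeffs_in_monom[OF one_in, of 1]
  by (intro CollectI exI[of _ "monom 1 1"]) (simp add: poly_monom)

lemma subring_adjoin: "subring_of (adjoin S x)"
proof
  show "1 \<in> adjoin S x" using adjoin_superset one_in by blast
next
  fix y z assume "y \<in> adjoin S x" "z \<in> adjoin S x"
  then obtain p q where "y = poly p x" "z = poly q x" "coeffs_in S p" "coeffs_in S q"
    by (auto simp: adjoin_def)
  then show "y - z \<in> adjoin S x" "y * z \<in> adjoin S x"
    unfolding adjoin_def
    by (auto intro: exI[of _ "p - q"] exI[of _ "p * q"] coeffs_in_diff coeffs_in_mult)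
qed

text \<open>Division with remainder becomes possible over any commutative ring once the dividend is multiplied by
  a power of the leading coefficient of the divisor. The degree of the quotient is bounded explicitly
  because leading coefficients may be zero divisors, so that degrees of products may drop.\<close>

lemma pseudo_division:
  assumes "coeffs_in S f" "coeffs_in S g"
  shows "\<exists>N q r. coeffs_in S q \<and> coeffs_in S r \<and> smult (lead_coeff g ^ N) f = q * g + r \<and>
    (r = 0 \<or> degree r < degree g) \<and> degree q \<le> degree f - degree g"
proof -
  have "\<exists>N q r. coeffs_in S q \<and> coeffs_in S r \<and> smult (lead_coeff g ^ N) f = q * g + r \<and>
    (r = 0 \<or> degree r < degree g) \<and> degree q \<le> degree f - degree g"
    if "coeffs_in S f" "f = 0 \<or> degree f < n" for n f
    using that
  proof (induction n arbitrary: f)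
    case 0
    then show ?case
      by (intro exI[of _ 0] exI[of _ 0] exI[of _ 0]) (simp add: coeffs_in_0)
  next
    case (Suc n)
    show ?case
    proof (cases "f = 0 \<or> degree f < degree g")
      case True
      then show ?thesis using Suc.prems
        by (intro exI[of _ 0] exI[of _ 0] exI[of _ f]) (auto simp: coeffs_in_0)
    next
      case False
      define t where "t = monom (lead_coeff f) (degree f - degree g)"
      define f' where "f' = smult (lead_coeff g) f - t * g"
      have c: "lead_coeff g \<in> S" "lead_coeff f \<in> S"
        using assms Suc.prems by (auto simp: coeffs_in_def)
      have t: "coeffs_in S t" unfolding t_def using c by (rule_tac coeffs_in_monom)
      have f': "coeffs_in S f'"
        unfolding f'_def using assms Suc.prems c t
        by (intro coeffs_in_diff coeffs_in_smult coeffs_in_mult) auto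
      have small: "coeff f' i = 0" if "i \<ge> degree f" for i
      proof (cases "i = degree f")
        case True
        then show ?thesis using False
          by (simp add: f'_def t_def coeff_monom_mult)
      next
        case i: False
        then have "coeff f i = 0" "coeff g (i - (degree f - degree g)) = 0"
          using that False by (auto intro!: coeff_eq_0)
        then show ?thesis by (simp add: f'_def t_def coeff_monom_mult)
      qed
      then have less: "f' = 0 \<or> degree f' < degree f"
        by (metis leading_coeff_0_iff not_le)
      with Suc.prems False have "f' = 0 \<or> degree f' < n" by auto
      from Suc.IH[OF f' this] obtain N q r where
        *: "coeffs_in S q" "coeffs_in S r" "smult (lead_coeff g ^ N) f' = q * g + r"
          "r = 0 \<or> degree r < degree g" "degree q \<le> degree f' - degree g" by blast
      have "smult (lead_coeff g ^ Suc N) f = (q + smult (lead_coeff g ^ N) t) * g + r"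
        using *(3) unfolding f'_def
        by (simp add: algebra_simps smult_diff_right)
      moreover have "degree (q + smult (lead_coeff g ^ N) t) \<le> degree f - degree g"
      proof (rule degree_add_le)
        show "degree q \<le> degree f - degree g" using less *(5) by auto
        show "degree (smult (lead_coeff g ^ N) t) \<le> degree f - degree g"
          unfolding t_def by (meson degree_monom_le degree_smult_le order_trans)
      qed
      moreover have "coeffs_in S (q + smult (lead_coeff g ^ N) t)"
        by (intro coeffs_in_add coeffs_in_smult * power_in c t)
      ultimately show ?thesis using * by blast
    qed
  qed
  from this[of f "Suc (degree f)"] assms show ?thesis by blast
qed

text \<open>Modulo a prime, a polynomial that is not zero has a representative whose leading coefficient is not
  zero; this stands in for passing to the quotient ring.\<close>

lemma drop_leading_terms_in_prime:
  assumes "prime_ideal P" and q: "coeffs_in S q" and "\<not> coeffs_in P q"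
  obtains q' where "coeffs_in S q'" "lead_coeff q' \<notin> P" "degree q' \<le> degree q" "coeffs_in P (q - q')"
proof -
  interpret P: prime_ideal P by fact
  define D where "D = {i. coeff q i \<notin> P}"
  have sub: "D \<subseteq> {..degree q}"
    unfolding D_def using P.zero_in by (auto intro: le_degree)
  have D: "finite D" "D \<noteq> {}"
    using finite_subset[OF sub] assms(3) by (auto simp: D_def coeffs_in_def)
  define d where "d = Max D"
  have d: "d \<in> D" "\<And>i. i \<in> D \<Longrightarrow> i \<le> d"
    using D by (auto simp: d_def)
  define q' where "q' = poly_cutoff (Suc d) q"
  have "coeff q' d \<noteq> 0" using d(1) P.zero_in by (auto simp: q'_def coeff_poly_cutoff D_def)
  moreover have "coeff q' i = 0" if "i > d" for i using that by (auto simp: q'_def coeff_poly_cutoff)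
  ultimately have deg: "degree q' = d"
    by (meson le_degree le_antisym leading_coeff_0_iff not_le coeff_0 degree_le)
  show thesis
  proof
    show "coeffs_in S q'" unfolding q'_def using q by (rule coeffs_in_poly_cutoff)
    show "lead_coeff q' \<notin> P" using d deg by (auto simp: q'_def coeff_poly_cutoff D_def)
    show "degree q' \<le> degree q" using d(1) sub deg by auto
    show "coeffs_in P (q - q')"
      unfolding coeffs_in_def
    proof
      fix i
      show "coeff (q - q') i \<in> P"
        using d(2)[of i] P.zero_in by (cases "i \<le> d") (auto simp: q'_def coeff_poly_cutoff D_def)
    qed
  qed
qed

end


section \<open>Hilbert's Nullstellensatz for prime ideals\<close>

abbreviation specialize :: "'k::comm_ring_1^'d \<Rightarrow> ('k, 'd::finite) mpoly poly \<Rightarrow> 'k poly" where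
  "specialize a \<equiv> map_poly (mpoly_eval a)"

lemma specialize_add: "specialize a (p + q) = specialize a p + specialize a q"
  by (rule poly_eqI) (simp add: coeff_map_poly)

lemma specialize_diff: "specialize a (p - q) = specialize a p - specialize a q"
  by (rule poly_eqI) (simp add: coeff_map_poly)

lemma specialize_mult: "specialize a (p * q) = specialize a p * specialize a q"
  by (rule poly_eqI) (simp add: coeff_map_poly coeff_mult)

lemma specialize_smult: "specialize a (smult c q) = smult (mpoly_eval a c) (specialize a q)"
  by (rule poly_eqI) (simp add: coeff_map_poly)

lemma specialize_eq_0:
  assumes "coeffs_in S q" "coeffs_in P q" "\<And>p. p \<in> P \<inter> S \<Longrightarrow> mpoly_eval a p = 0"
  shows "specialize a q = 0"
  using assms by (intro poly_eqI) (simp add: coeff_map_poly coeffs_in_def)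

lemma infinite_alg_closed_field: "infinite (UNIV :: 'k::alg_closed_field set)"
proof
  assume fin: "finite (UNIV :: 'k set)"
  \<comment> \<open>If the field were finite, this polynomial would take the value 1 everywhere.\<close>
  define p :: "'k poly" where "p = (\<Prod>c\<in>UNIV. [:- c, 1:]) + 1"
  have "degree (\<Prod>c\<in>UNIV. [:- c, 1:] :: 'k poly) = card (UNIV :: 'k set)"
    by (subst degree_prod_eq_sum_degree) auto
  moreover have "card (UNIV :: 'k set) > 0" using fin by (simp add: card_gt_0_iff)
  ultimately have "degree p > 0"
    unfolding p_def by (subst degree_add_eq_left) auto
  then obtain x where "poly p x = 0" using alg_closed_imp_poly_has_root by blast
  moreover have "poly p x = 1"
    unfolding p_def using fin by (auto simp: poly_prod prod_zero_iff)
  ultimately show False by simp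
qed

text \<open>The step from \<open>S\<close> to \<open>S[x]\<close>: a zero \<open>a\<close> of \<open>P \<inter> S\<close> with \<open>t(a) \<noteq> 0\<close> extends to a zero of \<open>P \<inter> S[x]\<close> at
  which the given element \<open>h(x) \<notin> P\<close> does not vanish, provided that \<open>t \<in> S - P\<close> is chosen suitably. If \<open>x\<close> is
  transcendental modulo \<open>P\<close>, take for \<open>t\<close> a coefficient of \<open>h\<close> outside \<open>P\<close>; all but finitely many \<open>\<xi>\<close> work. If \<open>x\<close> is
  algebraic, let \<open>g\<close> be its minimal polynomial, with leading coefficient \<open>c\<close>. Over the fraction field
  of \<open>S/(P \<inter> S)\<close> the polynomial \<open>g\<close> is irreducible, so \<open>g\<close> and \<open>h\<close> are coprime, and the ideal generated by
  \<open>P\<close> and \<open>h(x)\<close> contains a constant \<open>w0 \<in> S - P\<close>, which plays the role of a resultant; take \<open>t = c w0\<close> and any root \<open>\<xi>\<close> of the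
  specialization of \<open>g\<close>.\<close>

lemma extend_zero:
  fixes P S :: "('k::alg_closed_field, 'd::finite) mpoly set"
  assumes "prime_ideal P" "subring_of S" and h: "coeffs_in S h" "poly h x \<notin> P"
  obtains t where "t \<in> S" "t \<notin> P"
    "\<And>a. (\<And>p. p \<in> P \<inter> S \<Longrightarrow> mpoly_eval a p = 0) \<Longrightarrow> mpoly_eval a t \<noteq> 0 \<Longrightarrow>
      \<exists>\<xi>. (\<forall>q. coeffs_in S q \<and> poly q x \<in> P \<longrightarrow> poly (specialize a q) \<xi> = 0) \<and>
        poly (specialize a h) \<xi> \<noteq> 0"
proof -
  interpret P: prime_ideal P by fact
  interpret S: subring_of S by fact
  have cong: "poly q x \<in> P \<longleftrightarrow> poly q' x \<in> P" if "coeffs_in P (q - q')" for q q'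
  proof -
    have "poly (q - q') x \<in> P" using that by (intro P.poly_in) (auto simp: coeffs_in_def)
    then have *: "poly q x - poly q' x \<in> P" by simp
    show ?thesis
      using P.in_if_diff_in[OF *] P.diff_in[OF _ *, of "poly q x"] by auto
  qed
  show thesis
  proof (cases "\<forall>q. coeffs_in S q \<and> poly q x \<in> P \<longrightarrow> coeffs_in P q")
    case True
    have "\<not> coeffs_in P h"
      using h(2) P.poly_in[of h x] by (auto simp: coeffs_in_def)
    then obtain i where i: "coeff h i \<notin> P" by (auto simp: coeffs_in_def)
    show thesis
    proof (rule that[of "coeff h i"])
      show "coeff h i \<in> S" using h by (simp add: coeffs_in_def)
      show "coeff h i \<notin> P" by fact
    next
      fix a
      assume a: "\<And>p. p \<in> P \<inter> S \<Longrightarrow> mpoly_eval a p = 0" and "mpoly_eval a (coeff h i) \<noteq> 0"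
      then have "coeff (specialize a h) i \<noteq> 0" by (simp add: coeff_map_poly)
      then have "specialize a h \<noteq> 0" by auto
      then have "finite {\<xi>. poly (specialize a h) \<xi> = 0}" by (rule poly_roots_finite)
      then obtain \<xi> where "poly (specialize a h) \<xi> \<noteq> 0"
        using infinite_alg_closed_field[where 'k = 'k]
        by (metis (mono_tags, lifting) UNIV_I finite_subset mem_Collect_eq subsetI)
      moreover have "specialize a q = 0" if "coeffs_in S q" "poly q x \<in> P" for q
        using that True a by (intro specialize_eq_0[of S q P]) auto
      ultimately show "\<exists>\<xi>. (\<forall>q. coeffs_in S q \<and> poly q x \<in> P \<longrightarrow> poly (specialize a q) \<xi> = 0) \<and>
        poly (specialize a h) \<xi> \<noteq> 0" by auto
    qed
  next
    case False
    \<comment> \<open>The algebraic case: \<open>g\<close> is a polynomial of least degree that vanishes at \<open>x\<close> modulo \<open>P\<close> without being zero modulo \<open>P\<close>.\<close>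
    define G where "G q \<longleftrightarrow> coeffs_in S q \<and> poly q x \<in> P \<and> \<not> coeffs_in P q" for q
    define g0 where "g0 = arg_min degree G"
    have g0: "G g0" and g0_min: "\<And>q. G q \<Longrightarrow> degree g0 \<le> degree q"
      using arg_min_nat_lemma[of G _ degree] False unfolding g0_def G_def by blast+
    obtain g where g: "coeffs_in S g" "lead_coeff g \<notin> P" "degree g \<le> degree g0" "coeffs_in P (g0 - g)"
      using g0 S.drop_leading_terms_in_prime[OF assms(1), of g0]
      unfolding G_def by blast
    have gx: "poly g x \<in> P" using cong[OF g(4)] g0 by (simp add: G_def)
    have g_min: "coeffs_in P q" if "coeffs_in S q" "poly q x \<in> P" "degree q < degree g" for q
      using that g0_min[of q] g(3) unfolding G_def by force
    define c where "c = lead_coeff g"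
    have c: "c \<in> S" "c \<notin> P" using g by (auto simp: c_def coeffs_in_def)
    have deg_g: "degree g > 0"
    proof (rule ccontr)
      assume "\<not> degree g > 0"
      then have "g = [:c:]" by (metis c_def degree_eq_zeroE gr0I lead_coeff_pCons(2) degree_pCons_0 coeff_pCons_0)
      with gx c show False by simp
    qed
    \<comment> \<open>\<open>W\<close> describes the nonzero elements of the ideal generated by \<open>h(x)\<close> modulo \<open>P\<close>; one of least degree turns out to be constant.\<close>
    define W where "W w \<longleftrightarrow> coeffs_in S w \<and> poly w x \<notin> P \<and>
      (\<exists>u. coeffs_in S u \<and> poly w x - poly u x * poly h x \<in> P)" for w
    define w where "w = arg_min degree W"
    have "W h"
      unfolding W_def using h S.coeffs_in_monom[OF S.one_in, of 0] P.zero_in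
      by (auto intro!: exI[of _ "monom 1 0"] simp: poly_monom)
    then have w: "W w" and w_min: "\<And>q. W q \<Longrightarrow> degree w \<le> degree q"
      using arg_min_nat_lemma[of W _ degree] unfolding w_def by blast+
    obtain u where u: "coeffs_in S u" "poly w x - poly u x * poly h x \<in> P"
      using w by (auto simp: W_def)
    have wS: "coeffs_in S w" and wx: "poly w x \<notin> P" using w by (auto simp: W_def)
    have ideal: "W r" if "coeffs_in S r" "poly r x \<notin> P" "coeffs_in S q" "poly r x - poly q x * poly w x \<in> P" for r q
    proof -
      have "poly r x - poly (q * u) x * poly h x
          = (poly r x - poly q x * poly w x) + poly q x * (poly w x - poly u x * poly h x)"
        by (simp add: algebra_simps)
      also have "\<dots> \<in> P" using that u by (intro P.add_in P.mult_in)
      finally show ?thesis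
        unfolding W_def using that u S.coeffs_in_mult by blast
    qed
    have "degree w = 0"
    proof (rule ccontr)
      assume deg_w: "degree w \<noteq> 0"
      obtain w' where w': "coeffs_in S w'" "lead_coeff w' \<notin> P" "degree w' \<le> degree w" "coeffs_in P (w - w')"
        using S.drop_leading_terms_in_prime[OF assms(1) wS] wx P.poly_in[of w x]
        unfolding coeffs_in_def by blast
      have "poly (w - w') x \<in> P" using w'(4) by (intro P.poly_in) (auto simp: coeffs_in_def)
      then have diff: "poly w x - poly w' x \<in> P" by simp
      have w'x: "poly w' x \<notin> P" using cong[OF w'(4)] wx by simp
      have "W w'"
        using w' w'x P.uminus_in[OF diff] S.coeffs_in_monom[OF S.one_in, of 0]
        by (intro ideal[of w' "monom 1 0"]) (auto simp: poly_monom)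
      then have deg_w': "degree w' = degree w" using w_min w'(3) by force
      \<comment> \<open>Reducing \<open>w'\<close> modulo \<open>g\<close> stays in \<open>W\<close>, so \<open>w\<close> already has smaller degree than \<open>g\<close>.\<close>
      obtain N q r where 1: "coeffs_in S q" "coeffs_in S r" "smult (lead_coeff g ^ N) w' = q * g + r"
        "r = 0 \<or> degree r < degree g"
        using S.pseudo_division[OF w'(1) g(1)] by blast
      have "poly (smult (lead_coeff g ^ N) w') x = poly (q * g + r) x" using 1(3) by simp
      then have rx: "poly r x = lead_coeff g ^ N * poly w' x - poly q x * poly g x" by simp
      have "poly r x \<notin> P"
        unfolding rx using P.in_if_diff_in P.mult_in gx P.mult_notin P.power_notin g(2) w'x by meson
      moreover have "poly r x - poly [:lead_coeff g ^ N:] x * poly w x \<in> P"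
      proof -
        have "poly r x - poly [:lead_coeff g ^ N:] x * poly w x
            = - (lead_coeff g ^ N * (poly w x - poly w' x)) - poly q x * poly g x"
          unfolding rx by (simp add: algebra_simps)
        also have "\<dots> \<in> P" by (intro P.diff_in P.uminus_in P.mult_in diff gx)
        finally show ?thesis .
      qed
      moreover have "coeffs_in S [:lead_coeff g ^ N:]"
        using S.coeffs_in_monom[OF S.power_in[OF c(1)], of N 0] by (simp add: c_def monom_0)
      ultimately have "W r" using ideal 1(2) by blast
      then have "degree w \<le> degree r" using w_min by blast
      moreover have "r \<noteq> 0" using \<open>poly r x \<notin> P\<close> P.zero_in by auto
      ultimately have deg_wg: "degree w < degree g" using 1(4) by simp
      \<comment> \<open>Euclidean step: the remainder of \<open>g\<close> modulo \<open>w'\<close> has too small a degree for \<open>W\<close>, so it vanishes modulo \<open>P\<close> and \<open>w'\<close> would be a proper factor of the irreducible \<open>g\<close>.\<close>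
      obtain M q' r' where 2: "coeffs_in S q'" "coeffs_in S r'" "smult (lead_coeff w' ^ M) g = q' * w' + r'"
        "r' = 0 \<or> degree r' < degree w'" "degree q' \<le> degree g - degree w'"
        using S.pseudo_division[OF g(1) w'(1)] by blast
      have deg_r': "degree r' < degree w" using 2(4) deg_w deg_w' by auto
      have "poly (smult (lead_coeff w' ^ M) g) x = poly (q' * w' + r') x" using 2(3) by simp
      then have r'x: "poly r' x = lead_coeff w' ^ M * poly g x - poly q' x * poly w' x" by simp
      have "poly r' x \<in> P"
      proof (rule ccontr)
        assume r': "poly r' x \<notin> P"
        have "poly r' x - poly (- q') x * poly w x
            = lead_coeff w' ^ M * poly g x + poly q' x * (poly w x - poly w' x)"
          unfolding r'x by (simp add: algebra_simps)
        also have "\<dots> \<in> P" by (intro P.add_in P.mult_in gx diff)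
        finally have "W r'"
          using ideal[OF 2(2) r'] S.coeffs_in_diff[OF S.coeffs_in_0 2(1)] by simp
        then show False using w_min deg_r' by force
      qed
      then have r'P: "coeffs_in P r'" using g_min 2(2) deg_r' deg_wg by auto
      have "poly q' x * poly w' x = lead_coeff w' ^ M * poly g x - poly r' x"
        unfolding r'x by simp
      also have "\<dots> \<in> P" by (intro P.diff_in P.mult_in gx \<open>poly r' x \<in> P\<close>)
      finally have "poly q' x \<in> P" using P.prime w'x by blast
      moreover have "degree q' < degree g" using 2(5) deg_w deg_w' deg_g by linarith
      ultimately have q'P: "coeffs_in P q'" using g_min 2(1) by blast
      have "coeff (smult (lead_coeff w' ^ M) g) (degree g) = coeff (q' * w' + r') (degree g)"
        using 2(3) by simp
      also have "\<dots> \<in> P"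
        using q'P r'P by (auto simp: coeff_mult coeffs_in_def intro!: P.add_in P.sum_in P.mult_in')
      finally show False
        using P.mult_notin[OF P.power_notin[OF w'(2)] g(2), of M] by simp
    qed
    then obtain w0 where w0: "w = [:w0:]" by (meson degree_eq_zeroE)
    have w0S: "w0 \<in> S" "w0 \<notin> P" using wS wx w0 by (auto simp: coeffs_in_def elim: allE[of _ 0])
    show thesis
    proof (rule that[of "c * w0"])
      show "c * w0 \<in> S" using c w0S S.mult_in by blast
      show "c * w0 \<notin> P" using c w0S P.mult_notin by blast
    next
      fix a
      assume a: "\<And>p. p \<in> P \<inter> S \<Longrightarrow> mpoly_eval a p = 0" and "mpoly_eval a (c * w0) \<noteq> 0"
      then have nz: "mpoly_eval a c \<noteq> 0" "mpoly_eval a w0 \<noteq> 0" by auto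
      have "coeff (specialize a g) (degree g) \<noteq> 0" using nz by (simp add: c_def coeff_map_poly)
      then have "degree (specialize a g) > 0"
        using deg_g le_degree by (metis not_gr_zero le_zero_eq)
      then obtain \<xi> where \<xi>: "poly (specialize a g) \<xi> = 0"
        using alg_closed_imp_poly_has_root by blast
      \<comment> \<open>Modulo \<open>P\<close> and up to a power of \<open>c\<close>, every such \<open>q\<close> is a multiple of \<open>g\<close>.\<close>
      have vanish: "poly (specialize a q) \<xi> = 0" if q: "coeffs_in S q" "poly q x \<in> P" for q
      proof -
        obtain N q' r where 1: "coeffs_in S q'" "coeffs_in S r" "smult (lead_coeff g ^ N) q = q' * g + r"
          "r = 0 \<or> degree r < degree g"
          using S.pseudo_division[OF q(1) g(1)] by blast
        have "poly (smult (lead_coeff g ^ N) q) x = poly (q' * g + r) x" using 1(3) by simp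
        then have "poly r x = lead_coeff g ^ N * poly q x - poly q' x * poly g x" by simp
        also have "\<dots> \<in> P" by (intro P.diff_in P.mult_in q gx)
        finally have "coeffs_in P r"
          using g_min[OF 1(2)] 1(4) P.zero_in by (auto simp: coeffs_in_def)
        then have "specialize a r = 0" using specialize_eq_0[of S r P a] 1(2) a by blast
        then have "smult (mpoly_eval a c ^ N) (specialize a q) = specialize a q' * specialize a g"
          using arg_cong[OF 1(3), of "specialize a"]
          by (simp add: specialize_add specialize_mult specialize_smult c_def)
        then have "poly (smult (mpoly_eval a c ^ N) (specialize a q)) \<xi> = 0"
          using \<xi> by simp
        then show ?thesis using nz by simp
      qed
      have "poly (specialize a (w - u * h)) \<xi> = 0"
        using u wS h(1) by (intro vanish S.coeffs_in_diff S.coeffs_in_mult) auto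
      moreover have "specialize a w = [:mpoly_eval a w0:]"
        unfolding w0 by (simp add: map_poly_pCons)
      ultimately have "poly (specialize a h) \<xi> \<noteq> 0"
        using nz by (auto simp: specialize_diff specialize_mult)
      with vanish show "\<exists>\<xi>. (\<forall>q. coeffs_in S q \<and> poly q x \<in> P \<longrightarrow> poly (specialize a q) \<xi> = 0) \<and>
        poly (specialize a h) \<xi> \<noteq> 0" by blast
    qed
  qed
qed

definition mpoly_var :: "'d \<Rightarrow> ('k::comm_ring_1, 'd::finite) mpoly" where
  "mpoly_var i = Poly_Mapping.single (Poly_Mapping.single i 1) 1"

lemma mpoly_eval_var [simp]: "mpoly_eval a (mpoly_var i) = a $ i"
proof -
  have "(\<Prod>j\<in>UNIV. a $ j ^ Poly_Mapping.lookup (Poly_Mapping.single i 1) j) = (\<Prod>j\<in>UNIV. if j = i then a $ j else 1)"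
    by (intro prod.cong) (auto simp: lookup_single)
  then show ?thesis by (simp add: mpoly_var_def mpoly_eval_single)
qed

primrec mpolys_in :: "'d list \<Rightarrow> ('k::comm_ring_1, 'd::finite) mpoly set" where
  "mpolys_in [] = range mpoly_const"
| "mpolys_in (i # is) = adjoin (mpolys_in is) (mpoly_var i)"

lemma subring_mpolys_in: "subring_of (mpolys_in is :: ('k::comm_ring_1, 'd::finite) mpoly set)"
proof (induction "is")
  case Nil
  have "mpoly_const c - mpoly_const d = (mpoly_const (c - d) :: ('k, 'd) mpoly)"
    "mpoly_const c * mpoly_const d = (mpoly_const (c * d) :: ('k, 'd) mpoly)" for c d :: 'k
    by (simp_all add: mpoly_const_def mult_single single_diff)
  then show ?case
    by unfold_locales (auto simp: image_iff intro: exI[of _ 1])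
next
  case (Cons i "is")
  then show ?case by (simp add: subring_of.subring_adjoin)
qed

lemma mpolys_in_mono: "mpolys_in js \<subseteq> mpolys_in (is @ js)"
  by (induction "is") (use subring_of.adjoin_superset[OF subring_mpolys_in] in force)+

lemma mpoly_eq_sum_monomials:
  fixes p :: "('k::comm_ring_1, 'd::finite) mpoly"
  shows "p = (\<Sum>m\<in>Poly_Mapping.keys p. mpoly_const (Poly_Mapping.lookup p m) *
    (\<Prod>i\<in>UNIV. mpoly_var i ^ Poly_Mapping.lookup m i))"
proof -
  have pow: "mpoly_var i ^ n = (Poly_Mapping.single (Poly_Mapping.single i n) 1 :: ('k, 'd) mpoly)" for i n
    by (induction n) (auto simp: mpoly_var_def mult_single single_add[symmetric])
  have prod: "(\<Prod>i\<in>A. mpoly_var i ^ f i) = (Poly_Mapping.single (\<Sum>i\<in>A. Poly_Mapping.single i (f i)) 1 :: ('k, 'd) mpoly)"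
    if "finite A" for A :: "'d set" and f
    using that by induction (auto simp: pow mult_single)
  have "(\<Sum>i\<in>UNIV. Poly_Mapping.single i (Poly_Mapping.lookup m i)) = m" for m :: "'d \<Rightarrow>\<^sub>0 nat"
    by (rule poly_mapping_eqI) (simp add: lookup_sum lookup_single when_def)
  then show ?thesis
    by (simp add: prod mpoly_const_def mult_single sum_single_keys)
qed

lemma mpolys_in_all:
  assumes "set is = (UNIV :: 'd::finite set)"
  shows "mpolys_in is = (UNIV :: ('k::comm_ring_1, 'd) mpoly set)"
proof -
  interpret subring_of "mpolys_in is :: ('k, 'd) mpoly set" by (rule subring_mpolys_in)
  have var: "(mpoly_var i :: ('k, 'd) mpoly) \<in> mpolys_in is" for i
  proof -
    obtain js ks where "is = js @ i # ks" using assms by (metis UNIV_I in_set_conv_decomp)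
    then show ?thesis
      using mpolys_in_mono[of "i # ks" js] subring_of.adjoin_generator[OF subring_mpolys_in] by auto
  qed
  have const: "mpoly_const c \<in> mpolys_in is" for c :: 'k
    using mpolys_in_mono[of "[]" "is"] by auto
  have "p \<in> mpolys_in is" for p :: "('k, 'd) mpoly"
    by (subst mpoly_eq_sum_monomials) (intro sum_in mult_in const prod_in power_in var)
  then show ?thesis by blast
qed

lemma mpoly_eval_cong_mpolys_in:
  "p \<in> mpolys_in is \<Longrightarrow> (\<And>i. i \<in> set is \<Longrightarrow> a $ i = b $ i) \<Longrightarrow> mpoly_eval a p = mpoly_eval b p"
proof (induction "is" arbitrary: p)
  case Nil
  then show ?case by auto
next
  case (Cons i "is")
  then obtain q where q: "coeffs_in (mpolys_in is) q" "p = poly q (mpoly_var i)"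
    by (auto simp: adjoin_def)
  then have "mpoly_eval a (coeff q j) = mpoly_eval b (coeff q j)" for j
    using Cons by (auto simp: coeffs_in_def)
  then show ?case using Cons.prems(2)[of i] q(2) by (simp add: poly_altdef)
qed

lemma mpoly_eval_poly_var:
  assumes "coeffs_in (mpolys_in is) q" "i \<notin> set is"
  shows "mpoly_eval (\<chi> j. if j = i then \<xi> else a $ j) (poly q (mpoly_var i)) = poly (specialize a q) \<xi>"
proof -
  let ?b = "\<chi> j. if j = i then \<xi> else a $ j"
  have "mpoly_eval ?b (coeff q j) = mpoly_eval a (coeff q j)" for j
    using assms by (intro mpoly_eval_cong_mpolys_in[of _ "is"]) (auto simp: coeffs_in_def)
  moreover have deg: "degree (specialize a q) \<le> degree q"
    by (rule degree_le) (simp add: coeff_map_poly coeff_eq_0)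
  moreover have "poly (specialize a q) \<xi> = (\<Sum>j\<le>degree q. mpoly_eval a (coeff q j) * \<xi> ^ j)"
    using deg
    by (auto simp: poly_altdef coeff_map_poly intro!: sum.mono_neutral_left le_degree)
  ultimately show ?thesis by (simp add: poly_altdef)
qed

text \<open>Induction on the list of adjoined variables. As no variable outside the list occurs in the subring,
  the coordinate of the new variable can be changed to \<open>\<xi>\<close> without disturbing what is already known.\<close>

theorem nullstellensatz_prime:
  fixes P :: "('k::alg_closed_field, 'd::finite) mpoly set"
  assumes "prime_ideal P" "s \<notin> P"
  obtains a where "\<And>p. p \<in> P \<Longrightarrow> mpoly_eval a p = 0" "mpoly_eval a s \<noteq> 0"
proof -
  interpret P: prime_ideal P by fact
  have partial: "\<exists>a. (\<forall>p\<in>P \<inter> mpolys_in is. mpoly_eval a p = 0) \<and> mpoly_eval a s \<noteq> 0"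
    if "distinct is" "s \<in> mpolys_in is" "s \<notin> P" for "is" s
    using that
  proof (induction "is" arbitrary: s)
    case Nil
    have "c = 0" if "mpoly_const c \<in> P" for c
    proof (rule ccontr)
      assume "c \<noteq> 0"
      then have "mpoly_const (1 / c) * mpoly_const c = (1 :: ('k, 'd) mpoly)"
        by (simp add: mpoly_const_def mult_single)
      then show False using P.mult_in[OF that, of "mpoly_const (1 / c)"] P.one_notin by simp
    qed
    moreover obtain c where "s = mpoly_const c" using Nil by auto
    ultimately show ?case
      using Nil P.zero_in by (auto intro!: exI[of _ 0])
  next
    case (Cons i "is")
    obtain h where h: "coeffs_in (mpolys_in is) h" "s = poly h (mpoly_var i)"
      using Cons.prems by (auto simp: adjoin_def)
    obtain t where t: "t \<in> mpolys_in is" "t \<notin> P" and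
      ext: "\<And>a. (\<And>p. p \<in> P \<inter> mpolys_in is \<Longrightarrow> mpoly_eval a p = 0) \<Longrightarrow> mpoly_eval a t \<noteq> 0 \<Longrightarrow>
        \<exists>\<xi>. (\<forall>q. coeffs_in (mpolys_in is) q \<and> poly q (mpoly_var i) \<in> P \<longrightarrow> poly (specialize a q) \<xi> = 0) \<and>
          poly (specialize a h) \<xi> \<noteq> 0"
      using extend_zero[OF assms(1) subring_mpolys_in h(1), of "mpoly_var i"] h(2) Cons.prems(3) by blast
    obtain a where "\<forall>p\<in>P \<inter> mpolys_in is. mpoly_eval a p = 0" "mpoly_eval a t \<noteq> 0"
      using Cons.IH[OF _ t] Cons.prems by auto
    then obtain \<xi> where
      \<xi>: "\<And>q. coeffs_in (mpolys_in is) q \<Longrightarrow> poly q (mpoly_var i) \<in> P \<Longrightarrow> poly (specialize a q) \<xi> = 0"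
        "poly (specialize a h) \<xi> \<noteq> 0"
      using ext[of a] by blast
    define b where "b = (\<chi> j. if j = i then \<xi> else a $ j)"
    have eval_b: "mpoly_eval b (poly q (mpoly_var i)) = poly (specialize a q) \<xi>" if "coeffs_in (mpolys_in is) q" for q
      unfolding b_def using that Cons.prems by (intro mpoly_eval_poly_var) auto
    then have "\<forall>p\<in>P \<inter> mpolys_in (i # is). mpoly_eval b p = 0"
      using \<xi>(1) by (auto simp: adjoin_def)
    moreover have "mpoly_eval b s \<noteq> 0" using eval_b[OF h(1)] h(2) \<xi>(2) by simp
    ultimately show ?case by blast
  qed
  obtain "is" :: "'d list" where "set is = UNIV" "distinct is"
    using finite_distinct_list[of "UNIV :: 'd set"] by auto
  moreover have "(mpolys_in is :: ('k, 'd) mpoly set) = UNIV" by (rule mpolys_in_all) fact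
  ultimately obtain a where "\<forall>p\<in>P. mpoly_eval a p = 0" "mpoly_eval a s \<noteq> 0"
    using partial[of "is" s] assms(2) by auto
  then show thesis using that by blast
qed


section \<open>Minimal primes over an ideal\<close>

text \<open>
  The complement of a maximal multiplicative set \<open>S\<close> disjoint from \<open>b\<close> is a minimal prime over \<open>b\<close>. For
  \<open>x \<notin> S\<close>, the multiplicative set generated by \<open>S\<close> and \<open>x\<close> meets \<open>b\<close>, which is the stated nilpotency of
  \<open>x\<close> modulo \<open>b\<close> after localization.\<close>

lemma exists_prime_ideal_nilpotent_over:
  fixes b :: "'a::comm_ring_1 set"
  assumes zero: "0 \<in> b" and add: "\<And>x y. x \<in> b \<Longrightarrow> y \<in> b \<Longrightarrow> x + y \<in> b"
    and mult: "\<And>x r. x \<in> b \<Longrightarrow> r * x \<in> b" and proper: "1 \<notin> b"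
  obtains P where "prime_ideal P" "b \<subseteq> P" "\<And>x. x \<in> P \<Longrightarrow> \<exists>k u. u \<notin> P \<and> u * x ^ k \<in> b"
proof -
  define \<S> where "\<S> = {S :: 'a set. 1 \<in> S \<and> (\<forall>x\<in>S. \<forall>y\<in>S. x * y \<in> S) \<and> S \<inter> b = {}}"
  have "\<exists>S\<in>\<S>. \<forall>T\<in>\<S>. S \<subseteq> T \<longrightarrow> T = S"
  proof (rule subset_Zorn_nonempty)
    show "\<S> \<noteq> {}" using proper by (auto simp: \<S>_def intro!: exI[of _ "{1}"])
  next
    fix \<C> assume \<C>: "\<C> \<noteq> {}" "subset.chain \<S> \<C>"
    then have sub: "\<C> \<subseteq> \<S>" and total: "\<And>S T. S \<in> \<C> \<Longrightarrow> T \<in> \<C> \<Longrightarrow> S \<subseteq> T \<or> T \<subseteq> S"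
      by (auto simp: subset_chain_def)
    have "x * y \<in> \<Union>\<C>" if x: "S \<in> \<C>" "x \<in> S" and y: "T \<in> \<C>" "y \<in> T" for x y S T
    proof -
      obtain U where "U \<in> \<C>" "x \<in> U" "y \<in> U" using total[of S T] x y by blast
      moreover from this have "x * y \<in> U" using sub unfolding \<S>_def by blast
      ultimately show ?thesis by blast
    qed
    moreover have "1 \<in> \<Union>\<C>" using \<C>(1) sub unfolding \<S>_def by blast
    moreover have "\<Union>\<C> \<inter> b = {}" using sub unfolding \<S>_def by blast
    ultimately show "\<Union>\<C> \<in> \<S>" unfolding \<S>_def by blast
  qed
  then obtain S where S: "S \<in> \<S>" and max: "\<And>T. T \<in> \<S> \<Longrightarrow> S \<subseteq> T \<Longrightarrow> T = S" by blast
  have one: "1 \<in> S" and closed: "\<And>x y. x \<in> S \<Longrightarrow> y \<in> S \<Longrightarrow> x * y \<in> S" and disj: "S \<inter> b = {}"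
    using S by (auto simp: \<S>_def)
  have nilp: "\<exists>k. \<exists>u\<in>S. u * x ^ k \<in> b" if "x \<notin> S" for x
  proof (rule ccontr)
    assume *: "\<not> ?thesis"
    define T where "T = {u * x ^ k | u k. u \<in> S}"
    have "T \<in> \<S>"
      unfolding \<S>_def
    proof (intro CollectI conjI ballI)
      show "1 \<in> T" unfolding T_def using one by (intro CollectI exI[of _ 1] exI[of _ 0]) simp
      show "T \<inter> b = {}" using * by (auto simp: T_def)
      fix y z assume "y \<in> T" "z \<in> T"
      then obtain u k v l where "y = u * x ^ k" "z = v * x ^ l" "u \<in> S" "v \<in> S" by (auto simp: T_def)
      then show "y * z \<in> T"
        unfolding T_def using closed
        by (intro CollectI exI[of _ "u * v"] exI[of _ "k + l"]) (simp add: power_add mult_ac)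
    qed
    moreover have "S \<subseteq> T" unfolding T_def by (force intro: exI[of _ 0])
    moreover have "x \<in> T" unfolding T_def using one by (intro CollectI exI[of _ 1]) simp
    ultimately show False using max that by blast
  qed
  have saturated: "y \<in> S" if "x * y \<in> S" for x y
  proof (rule ccontr)
    assume "y \<notin> S"
    then obtain k u where "u \<in> S" "u * y ^ k \<in> b" using nilp by blast
    then have "x ^ k * (u * y ^ k) \<in> b" using mult by blast
    then have "u * (x * y) ^ k \<in> b" by (simp add: power_mult_distrib mult_ac)
    moreover have "(x * y) ^ k \<in> S" using that one closed by (induction k) auto
    ultimately show False using disj \<open>u \<in> S\<close> closed by blast
  qed
  have sum_notin: "x + y \<notin> S" if xy: "x \<notin> S" "y \<notin> S" for x y
  proof
    assume S: "x + y \<in> S"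
    obtain k u where u: "u \<in> S" "u * x ^ k \<in> b" using nilp xy by blast
    obtain l v where v: "v \<in> S" "v * y ^ l \<in> b" using nilp xy by blast
    \<comment> \<open>In every term of the binomial expansion \<open>x\<close> has exponent at least \<open>k\<close> or \<open>y\<close> has exponent at least \<open>l\<close>.\<close>
    have summand: "u * v * (of_nat ((k + l) choose i) * x ^ i * y ^ (k + l - i)) \<in> b" for i
    proof (cases "i \<ge> k")
      case True
      then have "u * v * (of_nat ((k + l) choose i) * x ^ i * y ^ (k + l - i))
        = (v * of_nat ((k + l) choose i) * x ^ (i - k) * y ^ (k + l - i)) * (u * x ^ k)"
        using power_add[of x k "i - k"] by (simp add: mult_ac)
      then show ?thesis using mult[OF u(2)] by simp
    next
      case False
      then have "k + l - i = l + (k - i)" by simp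
      then have "u * v * (of_nat ((k + l) choose i) * x ^ i * y ^ (k + l - i))
        = (u * of_nat ((k + l) choose i) * x ^ i * y ^ (k - i)) * (v * y ^ l)"
        by (simp add: mult_ac power_add)
      then show ?thesis using mult[OF v(2)] by simp
    qed
    have "sum f A \<in> b" if "\<And>i. f i \<in> b" for f :: "nat \<Rightarrow> 'a" and A
      by (induction A rule: infinite_finite_induct) (use zero add that in auto)
    from this[OF summand] have "u * v * (x + y) ^ (k + l) \<in> b"
      by (simp add: binomial_ring sum_distrib_left)
    moreover have "(x + y) ^ n \<in> S" for n using S one closed by (induction n) auto
    then have "u * v * (x + y) ^ (k + l) \<in> S" using u v closed by simp
    ultimately show False using disj by blast
  qed
  have "prime_ideal (- S)"
  proof
    show "0 \<in> - S" using zero disj by blast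
    show "x + y \<in> - S" if "x \<in> - S" "y \<in> - S" for x y using that sum_notin by blast
    show "r * x \<in> - S" if "x \<in> - S" for x r using that saturated by blast
    show "1 \<notin> - S" using one by blast
    show "x \<in> - S \<or> y \<in> - S" if "x * y \<in> - S" for x y using that closed by blast
  qed
  moreover have "\<exists>k u. u \<notin> - S \<and> u * x ^ k \<in> b" if "x \<in> - S" for x using nilp[of x] that by blast
  moreover have "b \<subseteq> - S" using disj by blast
  ultimately show thesis using that by blast
qed


section \<open>Submodules of free modules\<close>

locale vec_submodule =
  fixes M :: "('a::comm_ring_1^'n::finite) set"
  assumes zero_in: "0 \<in> M"
    and add_in: "f \<in> M \<Longrightarrow> g \<in> M \<Longrightarrow> f + g \<in> M"
    and scale_in: "f \<in> M \<Longrightarrow> c *s f \<in> M"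
begin

lemma uminus_in: "f \<in> M \<Longrightarrow> - f \<in> M"
proof -
  assume "f \<in> M"
  moreover have "(- 1) *s f = - f" by (simp add: vec_eq_iff)
  ultimately show ?thesis using scale_in[of f "- 1"] by simp
qed

lemma diff_in: "f \<in> M \<Longrightarrow> g \<in> M \<Longrightarrow> f - g \<in> M"
  using add_in[of f "- g"] uminus_in[of g] by simp

lemma sum_in: "(\<And>i. i \<in> A \<Longrightarrow> F i \<in> M) \<Longrightarrow> sum F A \<in> M"
  by (induction A rule: infinite_finite_induct) (auto simp: zero_in add_in)

end

lemma vec_eq_sum_axis:
  fixes g :: "'a::comm_ring_1^'n::finite"
  shows "g = (\<Sum>i\<in>UNIV. g $ i *s axis i 1)"
  by (simp add: vec_eq_iff axis_def if_distrib[of "(*) _"] cong: if_cong)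

text \<open>Among the submodules that contain \<open>M + P R\<^sup>n\<close> but no \<open>u f\<close> with \<open>u \<notin> P\<close>, choose a maximal one, \<open>L\<close>. By
  maximality the quotient by \<open>L\<close> has rank one over \<open>R/P\<close> and is spanned by \<open>f\<close> up to factors outside \<open>P\<close>:
  every \<open>e\<close> satisfies \<open>s e - \<phi> f \<in> L\<close> for some \<open>s \<notin> P\<close>. Taking for \<open>e\<close> the standard basis and a common
  denominator \<open>t\<close>, the coefficients \<open>\<phi>\<close> form the functional, with the denominators of
  its values in the fraction field of \<open>R/P\<close> cleared.\<close>

lemma separating_functional:
  fixes M :: "('a::comm_ring_1^'n::finite) set"
  assumes "vec_submodule M" "prime_ideal P"
    and f: "\<And>u m e. u \<notin> P \<Longrightarrow> m \<in> M \<Longrightarrow> (\<And>i. e $ i \<in> P) \<Longrightarrow> u *s f \<noteq> m + e"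
  obtains \<psi> where "\<And>g. g \<in> M \<Longrightarrow> (\<Sum>i\<in>UNIV. g $ i * \<psi> $ i) \<in> P" "(\<Sum>i\<in>UNIV. f $ i * \<psi> $ i) \<notin> P"
proof -
  interpret M: vec_submodule M by fact
  interpret P: prime_ideal P by fact
  define \<L> where "\<L> = {L. vec_submodule L \<and> M \<subseteq> L \<and> (\<forall>e. (\<forall>i. e $ i \<in> P) \<longrightarrow> e \<in> L) \<and> (\<forall>u. u \<notin> P \<longrightarrow> u *s f \<notin> L)}"
  define L0 where "L0 = {m + e | m e. m \<in> M \<and> (\<forall>i. e $ i \<in> P)}"
  have "vec_submodule L0"
  proof
    show "0 \<in> L0" unfolding L0_def using M.zero_in P.zero_in by (intro CollectI exI[of _ 0]) auto
  next
    fix g h assume "g \<in> L0" "h \<in> L0"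
    then obtain m e m' e' where "g = m + e" "h = m' + e'" "m \<in> M" "m' \<in> M" "\<forall>i. e $ i \<in> P" "\<forall>i. e' $ i \<in> P"
      by (auto simp: L0_def)
    then have "g + h = (m + m') + (e + e')" "m + m' \<in> M" "\<forall>i. (e + e') $ i \<in> P"
      by (auto simp: M.add_in P.add_in)
    then show "g + h \<in> L0" unfolding L0_def by blast
  next
    fix g c assume "g \<in> L0"
    then obtain m e where "g = m + e" "m \<in> M" "\<forall>i. e $ i \<in> P"
      by (auto simp: L0_def)
    then have "c *s g = c *s m + c *s e" "c *s m \<in> M" "\<forall>i. (c *s e) $ i \<in> P"
      by (auto simp: vector_add_ldistrib M.scale_in P.mult_in)
    then show "c *s g \<in> L0" unfolding L0_def by blast
  qed
  moreover have "m \<in> L0" if "m \<in> M" for m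
    unfolding L0_def using that P.zero_in by (intro CollectI exI[of _ m] exI[of _ 0]) auto
  moreover have "e \<in> L0" if "\<forall>i. e $ i \<in> P" for e
    unfolding L0_def using that M.zero_in by (intro CollectI exI[of _ 0] exI[of _ e]) auto
  moreover have "u *s f \<notin> L0" if "u \<notin> P" for u
    using f[OF that] unfolding L0_def by blast
  ultimately have L0: "L0 \<in> \<L>" by (auto simp: \<L>_def)
  have "\<exists>L\<in>\<L>. \<forall>L'\<in>\<L>. L \<subseteq> L' \<longrightarrow> L' = L"
  proof (rule subset_Zorn_nonempty)
    show "\<L> \<noteq> {}" using L0 by blast
  next
    fix \<C> assume \<C>: "\<C> \<noteq> {}" "subset.chain \<L> \<C>"
    then have sub: "\<C> \<subseteq> \<L>" and total: "\<And>S T. S \<in> \<C> \<Longrightarrow> T \<in> \<C> \<Longrightarrow> S \<subseteq> T \<or> T \<subseteq> S"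
      by (auto simp: subset_chain_def)
    have sm: "vec_submodule L" if "L \<in> \<C>" for L using that sub by (auto simp: \<L>_def)
    have "vec_submodule (\<Union>\<C>)"
    proof
      show "0 \<in> \<Union>\<C>" using \<C>(1) sm vec_submodule.zero_in by fast
    next
      fix g h assume "g \<in> \<Union>\<C>" "h \<in> \<Union>\<C>"
      then obtain L where "L \<in> \<C>" "g \<in> L" "h \<in> L" using total by blast
      then show "g + h \<in> \<Union>\<C>" using sm vec_submodule.add_in by blast
    next
      fix g c assume "g \<in> \<Union>\<C>"
      then show "c *s g \<in> \<Union>\<C>" using sm vec_submodule.scale_in by blast
    qed
    moreover obtain L1 where "L1 \<in> \<C>" using \<C>(1) by blast
    then have "M \<subseteq> \<Union>\<C>" "\<forall>e. (\<forall>i. e $ i \<in> P) \<longrightarrow> e \<in> \<Union>\<C>"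
      using sub unfolding \<L>_def by blast+
    moreover have "\<forall>u. u \<notin> P \<longrightarrow> u *s f \<notin> \<Union>\<C>" using sub unfolding \<L>_def by blast
    ultimately show "\<Union>\<C> \<in> \<L>" unfolding \<L>_def by blast
  qed
  then obtain L where L: "L \<in> \<L>" and max: "\<And>L'. L' \<in> \<L> \<Longrightarrow> L \<subseteq> L' \<Longrightarrow> L' = L" by blast
  interpret L: vec_submodule L using L by (simp add: \<L>_def)
  have M_L: "M \<subseteq> L" and P_L: "\<And>e. (\<And>i. e $ i \<in> P) \<Longrightarrow> e \<in> L" and fL: "\<And>u. u *s f \<in> L \<Longrightarrow> u \<in> P"
    using L by (auto simp: \<L>_def)
  have rank_one: "\<exists>s \<phi>. s \<notin> P \<and> s *s e - \<phi> *s f \<in> L" for e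
  proof (cases "e \<in> L")
    case True
    then show ?thesis using P.one_notin by (intro exI[of _ 1] exI[of _ 0]) simp
  next
    case False
    define L' where "L' = {g + c *s e | g c. g \<in> L}"
    have LL': "L \<subseteq> L'"
    proof
      fix g assume "g \<in> L"
      then show "g \<in> L'" unfolding L'_def by (intro CollectI exI[of _ g] exI[of _ 0]) auto
    qed
    have "e \<in> L'" unfolding L'_def using L.zero_in by (intro CollectI exI[of _ 0] exI[of _ 1]) auto
    have "vec_submodule L'"
    proof
      show "0 \<in> L'" using LL' L.zero_in by blast
    next
      fix g h assume "g \<in> L'" "h \<in> L'"
      then obtain g' c h' d where "g = g' + c *s e" "h = h' + d *s e" "g' \<in> L" "h' \<in> L"
        by (auto simp: L'_def)
      then show "g + h \<in> L'"
        unfolding L'_def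
        by (intro CollectI exI[of _ "g' + h'"] exI[of _ "c + d"]) (auto simp: vector_sadd_rdistrib L.add_in)
    next
      fix g r assume "g \<in> L'"
      then obtain g' c where "g = g' + c *s e" "g' \<in> L" by (auto simp: L'_def)
      then show "r *s g \<in> L'"
        unfolding L'_def
        by (intro CollectI exI[of _ "r *s g'"] exI[of _ "r * c"]) (auto simp: vector_add_ldistrib vector_smult_assoc L.scale_in)
    qed
    moreover have "L' \<notin> \<L>" using max[of L'] LL' \<open>e \<in> L'\<close> False by blast
    ultimately obtain r where r: "r \<notin> P" "r *s f \<in> L'"
      using M_L P_L LL' by (auto simp: \<L>_def)
    then obtain g c where gc: "r *s f = g + c *s e" "g \<in> L" by (auto simp: L'_def)
    have "c \<notin> P"
    proof
      assume "c \<in> P"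
      then have "c *s e \<in> L" by (intro P_L) (simp add: P.mult_in')
      then show False using gc L.add_in fL r by metis
    qed
    moreover have "c *s e - r *s f \<in> L" using L.uminus_in[OF gc(2)] gc(1) by simp
    ultimately show ?thesis by blast
  qed
  then have "\<forall>i. \<exists>s \<phi>. s \<notin> P \<and> s *s axis i 1 - \<phi> *s f \<in> L" by blast
  then obtain s \<phi> where s: "\<And>i. s i \<notin> P" and rel: "\<And>i. s i *s axis i 1 - \<phi> i *s f \<in> L" by metis
  define t where "t = prod s UNIV"
  define \<psi> where "\<psi> = (\<chi> i. prod s (UNIV - {i}) * \<phi> i)"
  have t: "t \<notin> P" unfolding t_def using s by (intro P.prod_notin)
  have rel_t: "t *s axis i 1 - \<psi> $ i *s f \<in> L" for i
  proof -
    have "t = prod s (UNIV - {i}) * s i" unfolding t_def by (subst prod.remove[of _ i]) auto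
    then have "t *s axis i 1 - \<psi> $ i *s f = prod s (UNIV - {i}) *s (s i *s axis i 1 - \<phi> i *s f)"
      by (simp add: \<psi>_def vec_eq_iff algebra_simps)
    then show ?thesis using L.scale_in[OF rel] by simp
  qed
  have rel_all: "t *s g - (\<Sum>i\<in>UNIV. g $ i * \<psi> $ i) *s f \<in> L" for g
  proof -
    have "t *s g - (\<Sum>i\<in>UNIV. g $ i * \<psi> $ i) *s f = (\<Sum>i\<in>UNIV. g $ i *s (t *s axis i 1 - \<psi> $ i *s f))"
      by (subst (1) vec_eq_sum_axis)
        (simp add: vec_eq_iff sum_distrib_left sum_distrib_right sum_subtractf algebra_simps)
    also have "\<dots> \<in> L" by (intro L.sum_in L.scale_in rel_t)
    finally show ?thesis .
  qed
  show thesis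
  proof
    fix g assume "g \<in> M"
    then have "t *s g \<in> L" using M_L L.scale_in by blast
    from L.diff_in[OF this rel_all[of g]] show "(\<Sum>i\<in>UNIV. g $ i * \<psi> $ i) \<in> P"
      by (intro fL) simp
  next
    have "t *s f - (\<Sum>i\<in>UNIV. f $ i * \<psi> $ i) *s f = (t - (\<Sum>i\<in>UNIV. f $ i * \<psi> $ i)) *s f"
      by (simp add: vec_eq_iff algebra_simps)
    then have "t - (\<Sum>i\<in>UNIV. f $ i * \<psi> $ i) \<in> P" using rel_all[of f] fL by simp
    then show "(\<Sum>i\<in>UNIV. f $ i * \<psi> $ i) \<notin> P" using t P.in_if_diff_in by blast
  qed
qed

definition row_value :: "'k::field^'d \<Rightarrow> ('k, 'd::finite) mpoly^'n::finite \<Rightarrow> 'k^'n \<Rightarrow> 'k" where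
  "row_value a f v = (\<Sum>i\<in>UNIV. mpoly_eval a (f $ i) * v $ i)"

text \<open>Induction on the sum of the exponents, for all multiples \<open>r e\<close> simultaneously: if all exponents are
  positive, then each multiple \<open>e\<^sub>i r e\<close> satisfies the hypothesis with the \<open>i\<close>-th exponent lowered, so it
  lies in \<open>M\<close>, and semiprimeness applies to \<open>r e\<close>.\<close>

lemma semiprime_submodule_power:
  assumes "vec_submodule M" and semiprime: "\<And>g. (\<And>i. g $ i *s g \<in> M) \<Longrightarrow> g \<in> M"
    and "\<And>i. e $ i ^ k i *s e \<in> M"
  shows "e \<in> M"
proof -
  interpret vec_submodule M by fact
  have "r *s e \<in> M" if "\<And>i. (e $ i ^ k i * r) *s e \<in> M" for r k
    using that
  proof (induction "sum k UNIV" arbitrary: k r rule: less_induct)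
    case less
    show ?case
    proof (cases "\<exists>i. k i = 0")
      case True
      then show ?thesis using less.prems by (metis mult_1 power_0)
    next
      case False
      have "(e $ i * r) *s e \<in> M" for i
      proof (rule less.hyps)
        have "k i > 0" using False by auto
        then show "sum (k(i := k i - 1)) UNIV < sum k UNIV"
          by (intro sum_strict_mono_ex1) (auto intro!: bexI[of _ i])
        show "(e $ j ^ (k(i := k i - 1)) j * (e $ i * r)) *s e \<in> M" for j
        proof (cases "j = i")
          case True
          have "e $ i ^ k i = e $ i ^ (k i - 1) * e $ i" using \<open>k i > 0\<close> by (rule power_minus_mult[symmetric])
          then show ?thesis using less.prems[of i] True by (simp add: mult.assoc)
        next
          case False
          then show ?thesis using scale_in[OF less.prems[of j], of "e $ i"] by (simp add: vector_smult_assoc mult_ac)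
        qed
      qed
      from scale_in[OF this, of r] show ?thesis
        by (rule_tac semiprime) (simp add: vector_smult_assoc mult_ac)
    qed
  qed
  from this[of k 1] assms(3) show ?thesis by simp
qed

theorem semiprime_submodule_nullstellensatz:
  fixes M :: "(('k::alg_closed_field, 'd::finite) mpoly^'n::finite) set"
  assumes "vec_submodule M" and semiprime: "\<And>g. (\<And>i. g $ i *s g \<in> M) \<Longrightarrow> g \<in> M"
    and vanish: "\<And>a v. (\<And>g. g \<in> M \<Longrightarrow> row_value a g v = 0) \<Longrightarrow> row_value a f v = 0"
  shows "f \<in> M"
proof (rule ccontr)
  interpret M: vec_submodule M by fact
  assume "f \<notin> M"
  define b where "b = {r. r *s f \<in> M}"
  obtain P where "prime_ideal P" and bP: "b \<subseteq> P" and nilp: "\<And>x. x \<in> P \<Longrightarrow> \<exists>k u. u \<notin> P \<and> u * x ^ k \<in> b"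
  proof (rule exists_prime_ideal_nilpotent_over[of b])
    show "0 \<in> b" by (simp add: b_def M.zero_in)
    show "1 \<notin> b" using \<open>f \<notin> M\<close> by (simp add: b_def)
    show "x + y \<in> b" if "x \<in> b" "y \<in> b" for x y
      using that M.add_in by (simp add: b_def vector_sadd_rdistrib)
    show "r * x \<in> b" if "x \<in> b" for x r
      using M.scale_in[of "x *s f" r] that by (simp add: b_def vector_smult_assoc)
  qed blast
  interpret P: prime_ideal P by fact
  have "\<exists>u m e. u \<notin> P \<and> m \<in> M \<and> (\<forall>i. e $ i \<in> P) \<and> u *s f = m + e"
  proof (rule ccontr)
    assume *: "\<not> ?thesis"
    obtain \<psi> where \<psi>: "\<And>g. g \<in> M \<Longrightarrow> (\<Sum>i\<in>UNIV. g $ i * \<psi> $ i) \<in> P" "(\<Sum>i\<in>UNIV. f $ i * \<psi> $ i) \<notin> P"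
      using separating_functional[OF assms(1) \<open>prime_ideal P\<close>, of f] * by blast
    obtain a where a: "\<And>p. p \<in> P \<Longrightarrow> mpoly_eval a p = 0" "mpoly_eval a (\<Sum>i\<in>UNIV. f $ i * \<psi> $ i) \<noteq> 0"
      using nullstellensatz_prime[OF \<open>prime_ideal P\<close> \<psi>(2)] by blast
    have eq: "row_value a g (\<chi> i. mpoly_eval a (\<psi> $ i)) = mpoly_eval a (\<Sum>i\<in>UNIV. g $ i * \<psi> $ i)" for g
      by (simp add: row_value_def)
    have "mpoly_eval a (\<Sum>i\<in>UNIV. f $ i * \<psi> $ i) = 0"
      unfolding eq[symmetric] by (rule vanish) (unfold eq, rule a(1)[OF \<psi>(1)])
    with a(2) show False by contradiction
  qed
  then obtain u m e where u: "u \<notin> P" and m: "m \<in> M" and e: "\<And>i. e $ i \<in> P" and ufme: "u *s f = m + e"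
    by blast
  have "\<forall>i. \<exists>k w. w \<notin> P \<and> w * e $ i ^ k \<in> b" using nilp e by blast
  then obtain k w where w: "\<And>i. w i \<notin> P" and wb: "\<And>i. w i * e $ i ^ k i \<in> b" by metis
  \<comment> \<open>Multiplying \<open>e\<close> by all the \<open>w i\<close> at once absorbs the factors outside \<open>P\<close>.\<close>
  define t where "t = prod w UNIV"
  have t: "t \<notin> P" unfolding t_def using w by (intro P.prod_notin)
  have nilpotent: "(t *s e) $ i ^ Suc (k i) *s (t *s e) \<in> M" for i
  proof -
    have eq: "t = prod w (UNIV - {i}) * w i" unfolding t_def by (subst prod.remove[of _ i]) auto
    have "(w i * e $ i ^ k i) *s f \<in> M" using wb[of i] by (simp add: b_def)
    then have "(w i * e $ i ^ k i) *s (u *s f - m) \<in> M"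
      using M.scale_in[of "(w i * e $ i ^ k i) *s f" u] M.scale_in[OF m, of "w i * e $ i ^ k i"]
      by (simp add: vector_ssub_ldistrib vector_smult_assoc M.diff_in mult_ac)
    then have "(w i * e $ i ^ k i) *s e \<in> M" using ufme by simp
    from M.scale_in[OF this, of "t ^ Suc (k i) * prod w (UNIV - {i}) * e $ i"] show ?thesis
      using eq by (simp add: vector_smult_assoc power_mult_distrib mult_ac)
  qed
  have "t *s e \<in> M"
    using assms(1)
  proof (rule semiprime_submodule_power[where k = "\<lambda>i. Suc (k i)"])
    show "g \<in> M" if "\<And>i. g $ i *s g \<in> M" for g using that by (rule semiprime)
  qed (rule nilpotent)
  then have "t *s (u *s f) \<in> M" unfolding ufme using m by (simp add: vector_add_ldistrib M.add_in M.scale_in)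
  then have "t * u \<in> b" by (simp add: b_def vector_smult_assoc)
  then show False using bP P.mult_notin[OF t u] by blast
qed


section \<open>Prime left ideals avoiding the powers of an element\<close>

lemma (in left_ideal) left_ideal_facts:
  shows subset_carrier: "I \<subseteq> carrier R" and zero_mem: "\<zero> \<in> I"
    and add_mem: "x \<in> I \<Longrightarrow> y \<in> I \<Longrightarrow> x \<oplus> y \<in> I"
  using additive_subgroup.a_subset[OF is_additive_subgroup] additive_subgroup.zero_closed[OF is_additive_subgroup]
    additive_subgroup.a_closed[OF is_additive_subgroup] by auto

context ring
begin

lemma left_idealI:
  assumes sub: "J \<subseteq> carrier R" and zero: "\<zero> \<in> J"
    and add: "\<And>x y. x \<in> J \<Longrightarrow> y \<in> J \<Longrightarrow> x \<oplus> y \<in> J"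
    and mult: "\<And>x y. x \<in> J \<Longrightarrow> y \<in> carrier R \<Longrightarrow> y \<otimes> x \<in> J"
  shows "left_ideal J R"
proof -
  have "\<ominus> x \<in> J" if "x \<in> J" for x
  proof -
    have "\<ominus> x = (\<ominus> \<one>) \<otimes> x" using that sub by (simp add: l_minus subset_iff)
    then show ?thesis using mult[OF that, of "\<ominus> \<one>"] by simp
  qed
  then have "subgroup J (add_monoid R)"
    using sub zero add by (intro subgroup.intro) (auto simp: a_inv_def)
  then have "additive_subgroup J R" by (rule additive_subgroup.intro)
  then show ?thesis
    using mult by (intro left_ideal.intro left_ideal_axioms.intro ring_axioms) auto
qed

lemma left_ideal_Union_chain:
  assumes "\<C> \<noteq> {}" "\<And>J. J \<in> \<C> \<Longrightarrow> left_ideal J R"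
    and total: "\<And>J K. J \<in> \<C> \<Longrightarrow> K \<in> \<C> \<Longrightarrow> J \<subseteq> K \<or> K \<subseteq> J"
  shows "left_ideal (\<Union>\<C>) R"
proof (rule left_idealI)
  show "\<Union>\<C> \<subseteq> carrier R" using left_ideal.subset_carrier[OF assms(2)] by blast
  show "\<zero> \<in> \<Union>\<C>" using assms(1) left_ideal.zero_mem[OF assms(2)] by blast
next
  fix x y assume "x \<in> \<Union>\<C>" "y \<in> \<Union>\<C>"
  then obtain J where J: "J \<in> \<C>" "x \<in> J" "y \<in> J" using total by blast
  then have "x \<oplus> y \<in> J" by (intro left_ideal.add_mem assms(2))
  with J show "x \<oplus> y \<in> \<Union>\<C>" by blast
next
  fix x y assume "x \<in> \<Union>\<C>" and y: "y \<in> carrier R"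
  then obtain J where J: "J \<in> \<C>" "x \<in> J" by blast
  then have "y \<otimes> x \<in> J" by (intro left_ideal.I_l_closed assms(2) y)
  with J show "y \<otimes> x \<in> \<Union>\<C>" by blast
qed

text \<open>Together with the lemmas below, this makes the union of the sums over all \<open>N\<close> the least left ideal
  that contains \<open>I\<close> and is stable under right multiplication by \<open>b\<close>.\<close>

lemma right_powers_sum_subset:
  assumes "left_ideal J R" "I \<subseteq> J" "b \<in> carrier R" and stable: "\<And>g. g \<in> J \<Longrightarrow> g \<otimes> b \<in> J"
  shows "right_powers_sum R I b N \<subseteq> J"
proof -
  interpret J: left_ideal J R by fact
  have power: "g \<otimes> b [^] (k::nat) \<in> J" if "g \<in> J" for g k
  proof (induction k)
    case 0
    then show ?case using that J.subset_carrier by auto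
  next
    case (Suc k)
    then show ?case
      using stable[OF Suc] that assms(3) J.subset_carrier by (auto simp: m_assoc)
  qed
  have "(\<Oplus>k\<in>{..n}. g k \<otimes> b [^] k) \<in> J" if "\<And>k. k \<le> n \<Longrightarrow> g k \<in> I" for g and n :: nat
  proof -
    have summand: "g k \<otimes> b [^] k \<in> J" if "k \<le> n" for k
      using power \<open>\<And>k. k \<le> n \<Longrightarrow> g k \<in> I\<close> that assms(2) by blast
    then have "(\<Oplus>k\<in>{..m}. g k \<otimes> b [^] k) \<in> J" if "m \<le> n" for m
      using that
    proof (induction m)
      case 0
      then show ?case using summand[of 0] J.subset_carrier by (simp add: subset_iff)
    next
      case (Suc m)
      have "(\<Oplus>k\<in>{..Suc m}. g k \<otimes> b [^] k) = g (Suc m) \<otimes> b [^] Suc m \<oplus> (\<Oplus>k\<in>{..m}. g k \<otimes> b [^] k)"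
        using summand Suc.prems J.subset_carrier by (intro finsum_Suc) (auto simp: subset_iff)
      then show ?case using Suc summand[of "Suc m"] J.add_mem by simp
    qed
    then show ?thesis by simp
  qed
  then show ?thesis by (auto simp: right_powers_sum_def)
qed

lemma right_powers_sum_Suc_mono:
  assumes "left_ideal I R" "b \<in> carrier R"
  shows "right_powers_sum R I b N \<subseteq> right_powers_sum R I b (Suc N)"
proof
  interpret I: left_ideal I R by fact
  fix x assume "x \<in> right_powers_sum R I b N"
  then obtain g where g: "\<forall>k\<le>N. g k \<in> I" "x = (\<Oplus>k\<in>{..N}. g k \<otimes> b [^] k)"
    by (auto simp: right_powers_sum_def)
  have carr: "g k \<otimes> b [^] k \<in> carrier R" if "k \<le> N" for k
    using g that assms(2) I.subset_carrier by auto
  define g' where "g' = g(Suc N := \<zero>)"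
  have "(\<Oplus>k\<in>{..Suc N}. g' k \<otimes> b [^] k) = g' (Suc N) \<otimes> b [^] Suc N \<oplus> (\<Oplus>k\<in>{..N}. g' k \<otimes> b [^] k)"
    using carr assms(2) by (intro finsum_Suc) (auto simp: g'_def le_Suc_eq)
  also have "(\<Oplus>k\<in>{..N}. g' k \<otimes> b [^] k) = x"
    unfolding g(2) using carr by (intro finsum_cong') (auto simp: g'_def)
  also have "g' (Suc N) \<otimes> b [^] Suc N \<oplus> x = x"
    using assms(2) carr unfolding g(2) by (auto simp: g'_def)
  finally have "x = (\<Oplus>k\<in>{..Suc N}. g' k \<otimes> b [^] k)" by simp
  moreover have "\<forall>k\<le>Suc N. g' k \<in> I" using g(1) I.zero_mem by (auto simp: g'_def le_Suc_eq)
  ultimately show "x \<in> right_powers_sum R I b (Suc N)" unfolding right_powers_sum_def by blast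
qed

lemma right_powers_sum_mono:
  assumes "left_ideal I R" "b \<in> carrier R" "N \<le> M"
  shows "right_powers_sum R I b N \<subseteq> right_powers_sum R I b M"
  using lift_Suc_mono_le[of "right_powers_sum R I b", OF right_powers_sum_Suc_mono[OF assms(1,2)] assms(3)] .

lemma left_ideal_right_powers_sum:
  assumes "left_ideal I R" "b \<in> carrier R"
  shows "left_ideal (right_powers_sum R I b N) R"
proof -
  interpret I: left_ideal I R by fact
  have carr: "g k \<otimes> b [^] k \<in> carrier R" if "\<forall>k\<le>N. g k \<in> I" "k \<le> N" for g k
    using that assms(2) I.subset_carrier by auto
  have carrI: "g \<in> carrier R" if "g \<in> I" for g using that I.subset_carrier by blast
  show ?thesis
  proof (rule left_idealI)
    show "right_powers_sum R I b N \<subseteq> carrier R"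
      using carr by (auto simp: right_powers_sum_def intro!: finsum_closed)
    have "(\<Oplus>k\<in>{..N}. \<zero> \<otimes> b [^] k) = \<zero>" using assms(2) by (simp add: add.finprod_one_eqI)
    then show "\<zero> \<in> right_powers_sum R I b N"
      unfolding right_powers_sum_def using I.zero_mem by (intro CollectI exI[of _ "\<lambda>_. \<zero>"]) auto
  next
    fix x y assume "x \<in> right_powers_sum R I b N" "y \<in> right_powers_sum R I b N"
    then obtain g h where g: "\<forall>k\<le>N. g k \<in> I" "x = (\<Oplus>k\<in>{..N}. g k \<otimes> b [^] k)"
      and h: "\<forall>k\<le>N. h k \<in> I" "y = (\<Oplus>k\<in>{..N}. h k \<otimes> b [^] k)"
      by (auto simp: right_powers_sum_def)
    have "x \<oplus> y = (\<Oplus>k\<in>{..N}. g k \<otimes> b [^] k \<oplus> h k \<otimes> b [^] k)"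
      unfolding g(2) h(2) using carr g(1) h(1) by (subst finsum_addf) auto
    also have "\<dots> = (\<Oplus>k\<in>{..N}. (g k \<oplus> h k) \<otimes> b [^] k)"
      using carr g(1) h(1) assms(2) carrI by (intro finsum_cong') (auto simp: l_distr)
    finally show "x \<oplus> y \<in> right_powers_sum R I b N"
      unfolding right_powers_sum_def using g(1) h(1) I.add_mem
      by (intro CollectI exI[of _ "\<lambda>k. g k \<oplus> h k"]) auto
  next
    fix x y assume "x \<in> right_powers_sum R I b N" and y: "y \<in> carrier R"
    then obtain g where g: "\<forall>k\<le>N. g k \<in> I" "x = (\<Oplus>k\<in>{..N}. g k \<otimes> b [^] k)"
      by (auto simp: right_powers_sum_def)
    have "y \<otimes> x = (\<Oplus>k\<in>{..N}. y \<otimes> (g k \<otimes> b [^] k))"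
      unfolding g(2) using carr g(1) y by (intro finsum_rdistr) auto
    also have "\<dots> = (\<Oplus>k\<in>{..N}. (y \<otimes> g k) \<otimes> b [^] k)"
      using carr g(1) y assms(2) carrI by (intro finsum_cong') (auto simp: m_assoc)
    finally show "y \<otimes> x \<in> right_powers_sum R I b N"
      unfolding right_powers_sum_def using g(1) y I.I_l_closed
      by (intro CollectI exI[of _ "\<lambda>k. y \<otimes> g k"]) auto
  qed
qed

lemma subset_right_powers_sum_0:
  assumes "left_ideal I R"
  shows "I \<subseteq> right_powers_sum R I b 0"
proof
  interpret I: left_ideal I R by fact
  fix x assume "x \<in> I"
  moreover from this have "x \<in> carrier R" using I.subset_carrier by blast
  ultimately show "x \<in> right_powers_sum R I b 0"
    by (auto simp: right_powers_sum_def intro!: exI[of _ "\<lambda>_. x"])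
qed

lemma right_powers_sum_mult_right:
  assumes "left_ideal I R" "b \<in> carrier R" "x \<in> right_powers_sum R I b N"
  shows "x \<otimes> b \<in> right_powers_sum R I b (Suc N)"
proof -
  interpret I: left_ideal I R by fact
  obtain g where g: "\<forall>k\<le>N. g k \<in> I" "x = (\<Oplus>k\<in>{..N}. g k \<otimes> b [^] k)"
    using assms(3) by (auto simp: right_powers_sum_def)
  have carrI: "g k \<in> carrier R" if "k \<le> N" for k using that g(1) I.subset_carrier by blast
  define g' where "g' k = (case k of 0 \<Rightarrow> \<zero> | Suc k \<Rightarrow> g k)" for k
  have "x \<otimes> b = (\<Oplus>k\<in>{..N}. g k \<otimes> b [^] k \<otimes> b)"
    unfolding g(2) using carrI assms(2) by (intro finsum_ldistr) auto
  also have "\<dots> = (\<Oplus>k\<in>{..N}. g' (Suc k) \<otimes> b [^] Suc k)"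
    using carrI assms(2) by (intro finsum_cong') (auto simp: g'_def m_assoc)
  also have "\<dots> = (\<Oplus>k\<in>{..N}. g' (Suc k) \<otimes> b [^] Suc k) \<oplus> g' 0 \<otimes> b [^] (0::nat)"
    using carrI assms(2) by (auto simp: g'_def intro!: r_zero[symmetric] finsum_closed)
  also have "\<dots> = (\<Oplus>k\<in>{..Suc N}. g' k \<otimes> b [^] k)"
    using carrI assms(2) by (intro finsum_Suc2[symmetric]) (auto simp: g'_def split: nat.splits)
  finally show ?thesis
    unfolding right_powers_sum_def using g(1) I.zero_mem
    by (intro CollectI exI[of _ g']) (auto simp: g'_def split: nat.splits)
qed

text \<open>Choose \<open>J\<close> maximal among the left ideals that contain \<open>I\<close>, are stable under right multiplication by \<open>b\<close>,
  and contain no power of \<open>b\<close>; the union of all \<open>I + I b + \<dots> + I b\<^sup>N\<close> shows that there are any. By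
  maximality, \<open>F b\<^sup>m \<in> J\<close> implies \<open>F \<in> J\<close>. If now \<open>x R y \<subseteq> J\<close> and \<open>y \<notin> J\<close>, then \<open>{F. x R F \<subseteq> J}\<close> is a
  strictly larger stable left ideal, so it contains some \<open>b\<^sup>m\<close>; hence \<open>x b\<^sup>m \<in> J\<close>, and \<open>x \<in> J\<close>.\<close>

theorem exists_prime_left_ideal_avoiding:
  assumes "left_ideal I R" and b: "b \<in> carrier R"
    and avoid: "\<And>N::nat. b [^] N \<notin> right_powers_sum R I b N"
  obtains J where "prime_left_ideal J R" "I \<subseteq> J" "b \<notin> J"
proof -
  define \<J> where "\<J> = {J. left_ideal J R \<and> I \<subseteq> J \<and> (\<forall>g\<in>J. g \<otimes> b \<in> J) \<and> (\<forall>N::nat. b [^] N \<notin> J)}"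
  have "(\<Union>N. right_powers_sum R I b N) \<in> \<J>"
    unfolding \<J>_def
  proof (intro CollectI conjI)
    have "right_powers_sum R I b N \<subseteq> right_powers_sum R I b M \<or>
        right_powers_sum R I b M \<subseteq> right_powers_sum R I b N" for N M
      using right_powers_sum_mono[OF assms(1) b] by (meson nat_le_linear)
    then show "left_ideal (\<Union>N. right_powers_sum R I b N) R"
      using left_ideal_right_powers_sum[OF assms(1) b] by (intro left_ideal_Union_chain) auto
    show "I \<subseteq> (\<Union>N. right_powers_sum R I b N)" using subset_right_powers_sum_0[OF assms(1)] by blast
    show "\<forall>g\<in>\<Union>N. right_powers_sum R I b N. g \<otimes> b \<in> (\<Union>N. right_powers_sum R I b N)"
      using right_powers_sum_mult_right[OF assms(1) b] by blast
    show "\<forall>N::nat. b [^] N \<notin> (\<Union>M. right_powers_sum R I b M)"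
    proof (intro allI notI)
      fix N :: nat assume "b [^] N \<in> (\<Union>M. right_powers_sum R I b M)"
      then obtain M where M: "b [^] N \<in> right_powers_sum R I b M" by blast
      show False
      proof (cases "M \<le> N")
        case True
        then show ?thesis using avoid M right_powers_sum_mono[OF assms(1) b] by blast
      next
        case False
        \<comment> \<open>The sum with index \<open>M\<close> is a left ideal, so it contains the higher power \<open>b\<^sup>M\<close> along with \<open>b\<^sup>N\<close>.\<close>
        then have "b [^] M = b [^] (M - N) \<otimes> b [^] N" using b by (simp add: nat_pow_mult)
        then show ?thesis
          using avoid[of M] left_ideal.I_l_closed[OF left_ideal_right_powers_sum[OF assms(1) b] M, of "b [^] (M - N)"] b
          by simp
      qed
    qed
  qed
  then have "\<J> \<noteq> {}" by blast
  have "\<exists>J\<in>\<J>. \<forall>K\<in>\<J>. J \<subseteq> K \<longrightarrow> K = J"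
  proof (rule subset_Zorn_nonempty[OF \<open>\<J> \<noteq> {}\<close>])
    fix \<C> assume \<C>: "\<C> \<noteq> {}" "subset.chain \<J> \<C>"
    then have sub: "\<C> \<subseteq> \<J>" and total: "\<And>J K. J \<in> \<C> \<Longrightarrow> K \<in> \<C> \<Longrightarrow> J \<subseteq> K \<or> K \<subseteq> J"
      by (auto simp: subset_chain_def)
    have "left_ideal (\<Union>\<C>) R"
      using \<C>(1) sub total by (intro left_ideal_Union_chain) (auto simp: \<J>_def)
    moreover obtain J1 where "J1 \<in> \<C>" using \<C>(1) by blast
    then have "I \<subseteq> \<Union>\<C>" using sub unfolding \<J>_def by blast
    moreover have "\<forall>g\<in>\<Union>\<C>. g \<otimes> b \<in> \<Union>\<C>" "\<forall>N::nat. b [^] N \<notin> \<Union>\<C>"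
      using sub unfolding \<J>_def by blast+
    ultimately show "\<Union>\<C> \<in> \<J>" unfolding \<J>_def by blast
  qed
  then obtain J where J: "J \<in> \<J>" and max: "\<And>K. K \<in> \<J> \<Longrightarrow> J \<subseteq> K \<Longrightarrow> K = J" by blast
  interpret J: left_ideal J R using J by (simp add: \<J>_def)
  have IJ: "I \<subseteq> J" and stable: "\<And>g. g \<in> J \<Longrightarrow> g \<otimes> b \<in> J" and powers: "\<And>N::nat. b [^] N \<notin> J"
    using J by (auto simp: \<J>_def)
  have stable_pow: "g \<otimes> b [^] (m::nat) \<in> J" if "g \<in> J" for g m
  proof (induction m)
    case 0
    then show ?case using that J.subset_carrier by auto
  next
    case (Suc m)
    then show ?case using stable[OF Suc] that b J.subset_carrier by (auto simp: m_assoc)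
  qed
  define K' where "K' = {F \<in> carrier R. \<exists>m::nat. F \<otimes> b [^] m \<in> J}"
  have "K' = J"
  proof (rule max)
    show "J \<subseteq> K'" using stable_pow J.subset_carrier by (auto simp: K'_def)
    show "K' \<in> \<J>"
      unfolding \<J>_def
    proof (intro CollectI conjI ballI allI notI)
      show "left_ideal K' R"
      proof (rule left_idealI)
        show "K' \<subseteq> carrier R" by (auto simp: K'_def)
        show "\<zero> \<in> K'" using \<open>J \<subseteq> K'\<close> J.zero_mem by blast
      next
        fix x y assume "x \<in> K'" "y \<in> K'"
        then obtain m n :: nat where x: "x \<in> carrier R" "x \<otimes> b [^] m \<in> J" and y: "y \<in> carrier R" "y \<otimes> b [^] n \<in> J"
          by (auto simp: K'_def)
        have "(x \<oplus> y) \<otimes> b [^] (m + n) = x \<otimes> b [^] m \<otimes> b [^] n \<oplus> y \<otimes> b [^] n \<otimes> b [^] m"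
          using x y b by (simp add: l_distr m_assoc nat_pow_mult add.commute)
        also have "\<dots> \<in> J" by (rule J.add_mem[OF stable_pow[OF x(2)] stable_pow[OF y(2)]])
        finally show "x \<oplus> y \<in> K'" using x y unfolding K'_def by blast
      next
        fix x y assume "x \<in> K'" and y: "y \<in> carrier R"
        then obtain m :: nat where x: "x \<in> carrier R" "x \<otimes> b [^] m \<in> J" by (auto simp: K'_def)
        then have "y \<otimes> x \<otimes> b [^] m \<in> J" using J.I_l_closed[OF x(2) y] y b by (simp add: m_assoc)
        then show "y \<otimes> x \<in> K'" using x y unfolding K'_def by blast
      qed
      show "I \<subseteq> K'" using IJ \<open>J \<subseteq> K'\<close> by blast
      fix x assume "x \<in> K'"
      then obtain m :: nat where x: "x \<in> carrier R" "x \<otimes> b [^] m \<in> J" by (auto simp: K'_def)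
      have "b \<otimes> b [^] m = b [^] m \<otimes> b" using b nat_pow_Suc2[of b m] by simp
      then have "x \<otimes> b \<otimes> b [^] m = x \<otimes> b [^] m \<otimes> b" using x b by (simp add: m_assoc)
      then have "x \<otimes> b \<otimes> b [^] m \<in> J" using stable[OF x(2)] by simp
      then show "x \<otimes> b \<in> K'" using x b unfolding K'_def by blast
    next
      fix N :: nat assume "b [^] N \<in> K'"
      then obtain m :: nat where "b [^] N \<otimes> b [^] m \<in> J" by (auto simp: K'_def)
      then show False using powers[of "N + m"] b by (simp add: nat_pow_mult)
    qed
  qed
  have "prime_left_ideal J R"
  proof (intro prime_left_ideal.intro J.left_ideal_axioms prime_left_ideal_axioms.intro)
    fix x y assume x: "x \<in> carrier R" and y: "y \<in> carrier R"
      and xy: "\<And>z. z \<in> carrier R \<Longrightarrow> x \<otimes> z \<otimes> y \<in> J"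
    show "x \<in> J \<or> y \<in> J"
    proof (rule disjCI)
      assume "y \<notin> J"
      define K where "K = {F \<in> carrier R. \<forall>z\<in>carrier R. x \<otimes> z \<otimes> F \<in> J}"
      have "left_ideal K R"
      proof (rule left_idealI)
        show "K \<subseteq> carrier R" by (auto simp: K_def)
        show "\<zero> \<in> K" using x J.zero_mem by (auto simp: K_def)
        show "F \<oplus> G \<in> K" if "F \<in> K" "G \<in> K" for F G
          using that x J.add_mem by (auto simp: K_def r_distr)
        show "w \<otimes> F \<in> K" if "F \<in> K" "w \<in> carrier R" for F w
        proof -
          have "x \<otimes> z \<otimes> (w \<otimes> F) = x \<otimes> (z \<otimes> w) \<otimes> F" if "z \<in> carrier R" for z
            using that x \<open>F \<in> K\<close> \<open>w \<in> carrier R\<close> by (simp add: K_def m_assoc)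
          then show ?thesis using that by (simp add: K_def)
        qed
      qed
      moreover have "J \<subseteq> K" using x J.I_l_closed J.subset_carrier by (auto simp: K_def)
      moreover have "F \<otimes> b \<in> K" if "F \<in> K" for F
        using that x b stable by (auto simp: K_def m_assoc[symmetric])
      moreover have "K \<notin> \<J>" using max[of K] \<open>J \<subseteq> K\<close> y xy \<open>y \<notin> J\<close> by (auto simp: K_def)
      ultimately obtain m :: nat where "b [^] m \<in> K" using IJ by (auto simp: \<J>_def)
      then have "x \<otimes> b [^] m \<in> J" using x by (force simp: K_def dest: bspec[of _ _ \<one>])
      then show "x \<in> J" using x \<open>K' = J\<close> by (auto simp: K'_def)
    qed
  qed
  moreover have "b \<notin> J" using powers[of 1] b by simp
  ultimately show thesis using IJ that by blast
qed

end


section \<open>Left ideals of matrix rings\<close>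

definition matrix_unit :: "'n \<Rightarrow> 'n \<Rightarrow> 'a::comm_ring_1^'n^'n::finite" where
  "matrix_unit p q = (\<chi> r s. if r = p \<and> s = q then 1 else 0)"

lemma mat_commute:
  fixes B :: "'a::comm_ring_1^'n^'n::finite"
  shows "mat c ** B = B ** mat c"
  by (simp add: vec_eq_iff matrix_matrix_mult_def mat_def if_distrib[of "\<lambda>x. _ * x"]
      if_distrib[of "\<lambda>x. x * _"] mult.commute cong: if_cong)

lemma matrix_unit_mult:
  fixes A :: "'a::comm_ring_1^'n^'n::finite"
  shows "matrix_unit k i ** A = (\<chi> r s. if r = k then A $ i $ s else 0)"
  by (simp add: vec_eq_iff matrix_matrix_mult_def matrix_unit_def if_distrib[of "\<lambda>x. x * _"] cong: if_cong)

text \<open>This places the scalar matrices of the entries of \<open>A\<close> in the two-sided ideal generated by \<open>A\<close>.\<close>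

lemma matrix_unit_sandwich:
  fixes A :: "'a::comm_ring_1^'n^'n::finite"
  shows "(\<Sum>k\<in>UNIV. matrix_unit k i ** A ** matrix_unit j k) = mat (A $ i $ j)"
proof -
  have "matrix_unit k i ** A ** matrix_unit j k = (\<chi> r s. if r = k then if s = k then A $ i $ j else 0 else 0)" for k
    unfolding matrix_unit_mult by (simp add: vec_eq_iff matrix_matrix_mult_def matrix_unit_def if_distrib[of "\<lambda>x. _ * x"] cong: if_cong)
  then have "(\<Sum>k\<in>UNIV. matrix_unit k i ** A ** matrix_unit j k) $ r $ s = mat (A $ i $ j) $ r $ s" for r s
    by (auto simp: mat_def)
  then show ?thesis by (simp add: vec_eq_iff)
qed

lemma sum_matrix_mult:
  fixes B :: "'a::comm_ring_1^'n^'n::finite" and f :: "'c \<Rightarrow> 'a^'n^'n"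
  shows "sum f A ** B = (\<Sum>k\<in>A. f k ** B)"
proof -
  have "(X + Y) ** B = X ** B + Y ** B" for X Y :: "'a^'n^'n"
    by (simp add: vec_eq_iff matrix_matrix_mult_def sum.distrib ring_distribs)
  moreover have "0 ** B = 0" by (simp add: vec_eq_iff matrix_matrix_mult_def)
  ultimately show ?thesis by (induction A rule: infinite_finite_induct) auto
qed

lemma matrix_eq_sum_units:
  fixes A :: "'a::comm_ring_1^'n^'n::finite"
  shows "A = (\<Sum>i\<in>UNIV. \<Sum>j\<in>UNIV. matrix_unit i j ** mat (A $ i $ j))"
proof -
  have "matrix_unit i j ** mat c = (\<chi> r s. if s = j then if r = i then c else 0 else 0)" for i j :: 'n and c :: 'a
    by (auto simp add: vec_eq_iff matrix_matrix_mult_def matrix_unit_def mat_def if_distrib[of "\<lambda>x. _ * x"] cong: if_cong)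
  then show ?thesis
    by (simp add: vec_eq_iff)
qed

lemma left_ideal_sum:
  fixes J :: "('a::comm_ring_1^'n^'n::finite) set"
  assumes "left_ideal J matrix_ring" "\<And>i. i \<in> A \<Longrightarrow> f i \<in> J"
  shows "sum f A \<in> J"
proof -
  interpret left_ideal J matrix_ring by fact
  show ?thesis
    using assms(2) zero_mem add_mem by (induction A rule: infinite_finite_induct) auto
qed

text \<open>If \<open>A X B \<in> J\<close> for all \<open>X\<close>, then \<open>J\<close> contains \<open>c B = B c\<close> for every entry \<open>c\<close> of \<open>A\<close>. The scalar matrix \<open>c\<close>
  is central, so \<open>J c \<subseteq> J\<close>, and complete primeness gives \<open>B \<in> J\<close> or \<open>c \<in> J\<close>. If all the entries of \<open>A\<close>
  lie in \<open>J\<close> as scalar matrices, so does \<open>A\<close>.\<close>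

lemma completely_prime_imp_prime:
  fixes J :: "('a::comm_ring_1^'n^'n::finite) set"
  assumes "completely_prime_left_ideal J matrix_ring"
  shows "prime_left_ideal J matrix_ring"
proof -
  interpret completely_prime_left_ideal J matrix_ring by fact
  have "A \<in> J \<or> B \<in> J" if prod: "\<And>X. A ** X ** B \<in> J" for A B
  proof (rule disjCI)
    assume "B \<notin> J"
    have "mat (A $ i $ j) \<in> J" for i j
    proof -
      have "mat (A $ i $ j) ** B = (\<Sum>k\<in>UNIV. matrix_unit k i ** (A ** matrix_unit j k ** B))"
        unfolding matrix_unit_sandwich[symmetric]
        by (simp add: sum_matrix_mult matrix_mul_assoc)
      also have "\<dots> \<in> J"
        using I_l_closed[OF prod] by (intro left_ideal_sum left_ideal_axioms) simp
      finally have "B ** mat (A $ i $ j) \<in> J" by (simp add: mat_commute)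
      moreover have "G ** mat (A $ i $ j) \<in> J" if "G \<in> J" for G
        using I_l_closed[OF that, of "mat (A $ i $ j)"] by (simp add: mat_commute)
      ultimately show ?thesis using completely_prime[of B "mat (A $ i $ j)"] \<open>B \<notin> J\<close> by auto
    qed
    then have "matrix_unit i j ** mat (A $ i $ j) \<in> J" for i j
      using I_l_closed[of "mat (A $ i $ j)" "matrix_unit i j"] by simp
    then show "A \<in> J"
      by (subst matrix_eq_sum_units) (intro left_ideal_sum left_ideal_axioms)
  qed
  then show ?thesis
    by (intro prime_left_ideal.intro prime_left_ideal_axioms.intro left_ideal_axioms) auto
qed

lemma prime_imp_semiprime:
  "prime_left_ideal J R \<Longrightarrow> semiprime_left_ideal J R"
  by (auto simp: prime_left_ideal_def semiprime_left_ideal_def semiprime_left_ideal_axioms_def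
      prime_left_ideal_axioms_def)

text \<open>For a left ideal this is the set of all rows of its elements; repeating a single row avoids the choice
  of a distinguished row index.\<close>

definition row_module :: "('a::comm_ring_1^'n^'n::finite) set \<Rightarrow> ('a^'n) set" where
  "row_module J = {f. (\<chi> i. f) \<in> J}"

lemma vec_submodule_row_module:
  fixes J :: "('a::comm_ring_1^'n^'n::finite) set"
  assumes "left_ideal J matrix_ring"
  shows "vec_submodule (row_module J)"
proof -
  interpret left_ideal J matrix_ring by fact
  have "(\<chi> i. 0) = (0 :: 'a^'n^'n)" "(\<chi> i. f + g) = ((\<chi> i. f) + (\<chi> i. g) :: 'a^'n^'n)"
    "(\<chi> i. c *s f) = (mat c ** (\<chi> i. f) :: 'a^'n^'n)" for c :: 'a and f g :: "'a^'n"
    by (simp_all add: vec_eq_iff matrix_matrix_mult_def mat_def if_distrib[of "\<lambda>x. x * _"] cong: if_cong)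
  then show ?thesis
    using zero_mem add_mem I_l_closed by unfold_locales (auto simp: row_module_def)
qed

lemma mem_iff_rows:
  fixes J :: "('a::comm_ring_1^'n^'n::finite) set"
  assumes "left_ideal J matrix_ring"
  shows "F \<in> J \<longleftrightarrow> (\<forall>i. F $ i \<in> row_module J)"
proof -
  interpret left_ideal J matrix_ring by fact
  have "((\<chi> k. F $ i) :: 'a^'n^'n) = (\<chi> r s. if s = i then 1 else 0) ** F" for i
    by (simp add: vec_eq_iff matrix_matrix_mult_def if_distrib[of "\<lambda>x. x * _"] cong: if_cong)
  then have "F $ i \<in> row_module J" if "F \<in> J" for i
    using I_l_closed[OF that, of "\<chi> r s. if s = i then 1 else 0"] by (simp add: row_module_def)
  moreover have "F = (\<Sum>i\<in>UNIV. matrix_unit i i ** (\<chi> k. F $ i))"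
    by (simp add: vec_eq_iff matrix_unit_mult)
  then have "F \<in> J" if "\<forall>i. F $ i \<in> row_module J"
    using that left_ideal_sum[OF assms, of UNIV "\<lambda>i. matrix_unit i i ** (\<chi> k. F $ i)"] I_l_closed
    by (auto simp: row_module_def)
  ultimately show ?thesis by blast
qed

text \<open>If all rows of \<open>A\<close> are equal to \<open>f\<close>, then all rows of \<open>A X A\<close> are equal to the same linear combination of
  the \<open>f\<^sub>i f\<close>.\<close>

lemma semiprime_row_module:
  fixes J :: "('a::comm_ring_1^'n^'n::finite) set"
  assumes "semiprime_left_ideal J matrix_ring" and f: "\<And>i. f $ i *s f \<in> row_module J"
  shows "f \<in> row_module J"
proof -
  interpret semiprime_left_ideal J matrix_ring by fact
  interpret M: vec_submodule "row_module J" using left_ideal_axioms by (rule vec_submodule_row_module)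
  have "(\<chi> i. f) ** X ** (\<chi> i. f) \<in> J" for X :: "'a^'n^'n"
  proof -
    have "(\<Sum>j\<in>UNIV. \<Sum>l\<in>UNIV. X $ j $ l *s (f $ j *s f)) \<in> row_module J"
      by (intro M.sum_in M.scale_in f)
    moreover have "(\<Sum>j\<in>UNIV. \<Sum>l\<in>UNIV. X $ j $ l *s (f $ j *s f)) $ m = ((\<chi> i. f) ** X ** (\<chi> i. f)) $ i $ m" for i m :: 'n
      by (simp add: matrix_matrix_mult_def sum_distrib_left mult_ac) (rule sum.swap)
    then have "((\<chi> i. (\<Sum>j\<in>UNIV. \<Sum>l\<in>UNIV. X $ j $ l *s (f $ j *s f))) :: 'a^'n^'n) = (\<chi> i. f) ** X ** (\<chi> i. f)"
      by (simp only: vec_eq_iff vec_lambda_beta) blast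
    ultimately show ?thesis by (simp add: row_module_def)
  qed
  then show ?thesis using semiprime[of "\<chi> i. f"] by (simp add: row_module_def)
qed


section \<open>Ideals of directional points\<close>

lemma eval_matrix_mult:
  fixes F G :: "('k::field, 'd::finite, 'n::finite) matrix_poly"
  shows "map_matrix (mpoly_eval a) (F ** G) = map_matrix (mpoly_eval a) F ** map_matrix (mpoly_eval a) G"
  by (simp add: vec_eq_iff matrix_matrix_mult_def)

lemma eval_matrix_add:
  fixes F G :: "('k::field, 'd::finite, 'n::finite) matrix_poly"
  shows "map_matrix (mpoly_eval a) (F + G) = map_matrix (mpoly_eval a) F + map_matrix (mpoly_eval a) G"
  by (simp add: vec_eq_iff)

lemma eval_const_matrix: "map_matrix (mpoly_eval a) (map_matrix mpoly_const A) = A"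
  by (simp add: vec_eq_iff)

lemma eval_matrix_one: "map_matrix (mpoly_eval a) (mat 1) = mat 1"
  by (simp add: vec_eq_iff mat_def)

definition point_ideal :: "'k^'d \<Rightarrow> 'k^'n \<Rightarrow> ('k::field, 'd::finite, 'n::finite) matrix_poly set" where
  "point_ideal a v = {F. annihilates F a v}"

lemma left_ideal_point_ideal: "left_ideal (point_ideal a v) matrix_ring"
proof (rule ring.left_idealI[OF ring_matrix_ring])
  show "\<zero>\<^bsub>matrix_ring\<^esub> \<in> point_ideal a v"
    by (simp add: point_ideal_def annihilates_def matrix_vector_mult_def vec_eq_iff)
qed (auto simp: point_ideal_def annihilates_def eval_matrix_mult eval_matrix_add
    matrix_vector_mult_add_rdistrib matrix_vector_mul_assoc[symmetric])

lemma exists_matrix_mapping: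
  fixes v w :: "'k::field^'n::finite"
  assumes "w \<noteq> 0"
  obtains A where "A *v w = v"
proof -
  obtain l where "w $ l \<noteq> 0" using assms by (auto simp: vec_eq_iff)
  then have "(\<chi> i j. if j = l then v $ i / w $ l else 0) *v w = v"
    by (simp add: vec_eq_iff matrix_vector_mult_def if_distrib[of "\<lambda>x. x * _"] cong: if_cong)
  then show thesis by (rule that)
qed

text \<open>If \<open>G(a) v \<noteq> 0\<close>, a constant matrix moves it back to \<open>v\<close>.\<close>

lemma prime_point_ideal:
  fixes a :: "'k::field^'d::finite" and v :: "'k^'n::finite"
  shows "prime_left_ideal (point_ideal a v) matrix_ring"
proof (intro prime_left_ideal.intro prime_left_ideal_axioms.intro left_ideal_point_ideal)
  fix F G :: "('k, 'd, 'n) matrix_poly"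
  assume prod: "\<And>X. X \<in> carrier matrix_ring \<Longrightarrow> F \<otimes>\<^bsub>matrix_ring\<^esub> X \<otimes>\<^bsub>matrix_ring\<^esub> G \<in> point_ideal a v"
  show "F \<in> point_ideal a v \<or> G \<in> point_ideal a v"
  proof (rule disjCI)
    define w where "w = map_matrix (mpoly_eval a) G *v v"
    assume "G \<notin> point_ideal a v"
    then have "w \<noteq> 0" by (simp add: w_def point_ideal_def annihilates_def)
    then obtain A where "A *v w = v" by (rule exists_matrix_mapping)
    then show "F \<in> point_ideal a v"
      using prod[of "map_matrix mpoly_const A"]
      by (simp add: w_def point_ideal_def annihilates_def eval_matrix_mult eval_const_matrix matrix_vector_mul_assoc[symmetric])
  qed
qed

lemma proportional_if_killed:
  fixes v w :: "'k::field^'n::finite"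
  assumes "v \<noteq> 0" and killed: "\<And>A :: 'k^'n^'n. A *v v = 0 \<Longrightarrow> A *v w = 0"
  obtains c where "w = c *s v"
proof -
  obtain l where l: "v $ l \<noteq> 0" using assms(1) by (auto simp: vec_eq_iff)
  \<comment> \<open>Every row of \<open>A j\<close> is the form that sends \<open>x\<close> to \<open>v\<^sub>l x\<^sub>j - v\<^sub>j x\<^sub>l\<close>; these forms cut out the line of \<open>v\<close>.\<close>
  define A :: "'n \<Rightarrow> 'k^'n^'n"
    where "A j = (\<chi> r s. v $ l * (if s = j then 1 else 0) - v $ j * (if s = l then 1 else 0))" for j
  have "(A j *v x) $ r = v $ l * x $ j - v $ j * x $ l" for j x r
    by (simp add: A_def matrix_vector_mult_def left_diff_distrib sum_subtractf if_distrib[of "\<lambda>x. x * _"]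
        if_distrib[of "\<lambda>x. _ * x"] cong: if_cong)
  then have "v $ l * w $ j - v $ j * w $ l = 0" for j
    using killed[of "A j"] by (simp add: vec_eq_iff mult.commute)
  then have "w = (w $ l / v $ l) *s v"
    using l by (simp add: vec_eq_iff field_simps)
  then show thesis by (rule that)
qed

text \<open>Stability under right multiplication by \<open>G\<close>, applied to the constant matrices that kill \<open>v\<close>, forces
  \<open>G(a) v = c v\<close>; so \<open>F(a) G(a) v = c F(a) v\<close>, and \<open>c = 0\<close> or \<open>F(a) v = 0\<close>.\<close>

lemma completely_prime_point_ideal:
  fixes a :: "'k::field^'d::finite" and v :: "'k^'n::finite"
  assumes "v \<noteq> 0"
  shows "completely_prime_left_ideal (point_ideal a v) matrix_ring"
proof (intro completely_prime_left_ideal.intro completely_prime_left_ideal_axioms.intro left_ideal_point_ideal)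
  fix F G :: "('k, 'd, 'n) matrix_poly"
  assume prod: "F \<otimes>\<^bsub>matrix_ring\<^esub> G \<in> point_ideal a v"
    and stable: "\<And>H. H \<in> point_ideal a v \<Longrightarrow> H \<otimes>\<^bsub>matrix_ring\<^esub> G \<in> point_ideal a v"
  define w where "w = map_matrix (mpoly_eval a) G *v v"
  have "A *v w = 0" if "A *v v = 0" for A :: "'k^'n^'n"
    using stable[of "map_matrix mpoly_const A"] that
    by (simp add: w_def point_ideal_def annihilates_def eval_matrix_mult eval_const_matrix matrix_vector_mul_assoc[symmetric])
  with assms obtain c where c: "w = c *s v" by (rule proportional_if_killed)
  show "F \<in> point_ideal a v \<or> G \<in> point_ideal a v"
  proof (cases "c = 0")
    case True
    then show ?thesis using c by (simp add: w_def point_ideal_def annihilates_def)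
  next
    case False
    have "map_matrix (mpoly_eval a) F *v w = 0"
      using prod by (simp add: w_def point_ideal_def annihilates_def eval_matrix_mult matrix_vector_mul_assoc[symmetric])
    then have "c *s (map_matrix (mpoly_eval a) F *v v) = 0"
      unfolding c by (simp add: vector_scalar_commute)
    then show ?thesis using False by (simp add: point_ideal_def annihilates_def)
  qed
qed


section \<open>The directional radical\<close>

lemma directional_radical_eq_Inter:
  "directional_radical I = \<Inter>{point_ideal a v | a v. v \<noteq> 0 \<and> I \<subseteq> point_ideal a v}"
  by (auto simp: directional_radical_def point_ideal_def)

lemma subset_directional_radical: "I \<subseteq> directional_radical I"
  by (auto simp: directional_radical_def)

lemma directional_radical_mono: "I \<subseteq> J \<Longrightarrow> directional_radical I \<subseteq> directional_radical J"
  unfolding directional_radical_def by blast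

lemma left_ideal_directional_radical: "left_ideal (directional_radical I) matrix_ring"
proof (rule ring.left_idealI[OF ring_matrix_ring])
  show "\<zero>\<^bsub>matrix_ring\<^esub> \<in> directional_radical I"
    by (simp add: directional_radical_def annihilates_def matrix_vector_mult_def vec_eq_iff)
qed (auto simp: directional_radical_def annihilates_def eval_matrix_mult eval_matrix_add
    matrix_vector_mult_add_rdistrib matrix_vector_mul_assoc[symmetric])

lemma semiprime_directional_radical:
  fixes I :: "('k::field, 'd::finite, 'n::finite) matrix_poly set"
  shows "semiprime_left_ideal (directional_radical I) matrix_ring"
proof (intro semiprime_left_ideal.intro semiprime_left_ideal_axioms.intro left_ideal_directional_radical)
  fix F :: "('k, 'd, 'n) matrix_poly"
  assume prod: "\<And>X. X \<in> carrier matrix_ring \<Longrightarrow> F \<otimes>\<^bsub>matrix_ring\<^esub> X \<otimes>\<^bsub>matrix_ring\<^esub> F \<in> directional_radical I"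
  have "F \<in> point_ideal a v" if "v \<noteq> 0" "I \<subseteq> point_ideal a v" for a v
  proof -
    have "F ** X ** F \<in> point_ideal a v" for X
      using prod[of X] that unfolding directional_radical_eq_Inter by auto
    then show ?thesis using prime_left_ideal.prime[OF prime_point_ideal, of F F a v] by simp
  qed
  then show "F \<in> directional_radical I"
    unfolding directional_radical_eq_Inter by blast
qed

theorem directional_radical_subset_semiprime:
  fixes I J :: "('k::alg_closed_field, 'd::finite, 'n::finite) matrix_poly set"
  assumes "semiprime_left_ideal J matrix_ring" "I \<subseteq> J"
  shows "directional_radical I \<subseteq> J"
proof
  interpret semiprime_left_ideal J matrix_ring by fact
  fix F assume "F \<in> directional_radical I"
  then have F: "F \<in> directional_radical J" using directional_radical_mono[OF assms(2)] by blast
  have eval: "(map_matrix (mpoly_eval a) G *v v) $ i = row_value a (G $ i) v"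
    for a and v :: "'k^'n" and G :: "('k, 'd, 'n) matrix_poly" and i
    by (simp add: matrix_vector_mult_def row_value_def)
  have "F $ i \<in> row_module J" for i
  proof (rule semiprime_submodule_nullstellensatz)
    show "vec_submodule (row_module J)" using left_ideal_axioms by (rule vec_submodule_row_module)
    show "g \<in> row_module J" if "\<And>i. g $ i *s g \<in> row_module J" for g
      using assms(1) that by (rule semiprime_row_module)
  next
    fix a and v :: "'k^'n"
    assume v: "\<And>g. g \<in> row_module J \<Longrightarrow> row_value a g v = 0"
    have "annihilates G a v" if "G \<in> J" for G
      using that v mem_iff_rows[OF left_ideal_axioms] by (simp add: annihilates_def vec_eq_iff eval)
    \<comment> \<open>For \<open>v = 0\<close>, which is no directional point, the claim is trivial.\<close>
    then have "annihilates F a v" if "v \<noteq> 0" using F that by (simp add: directional_radical_def)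
    then show "row_value a (F $ i) v = 0"
      unfolding eval[symmetric] by (cases "v = 0") (auto simp: annihilates_def)
  qed
  then show "F \<in> J" using mem_iff_rows[OF left_ideal_axioms] by blast
qed

lemma directional_radical_powers:
  fixes I :: "('k::alg_closed_field, 'd::finite, 'n::finite) matrix_poly set"
  assumes "left_ideal I matrix_ring" "B \<in> directional_radical I"
  shows "\<exists>N::nat. B [^]\<^bsub>matrix_ring\<^esub> N \<in> right_powers_sum matrix_ring I B N"
proof (rule ccontr)
  assume "\<not> ?thesis"
  then obtain J where "prime_left_ideal J matrix_ring" "I \<subseteq> J" "B \<notin> J"
    using ring.exists_prime_left_ideal_avoiding[OF ring_matrix_ring assms(1), of B] by auto
  then show False
    using directional_radical_subset_semiprime prime_imp_semiprime assms(2) by blast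
qed

text \<open>If \<open>I\<close> annihilates \<open>(a, v)\<close> and \<open>B(a) v = v\<close>, then \<open>point_ideal a v\<close> is stable under right
  multiplication by \<open>B\<close>, hence contains \<open>I + I B + \<dots> + I B\<^sup>N\<close>, but \<open>B\<^sup>N(a) v = v\<close>.\<close>

lemma mem_directional_radical_if_powers:
  fixes I :: "('k::field, 'd::finite, 'n::finite) matrix_poly set"
  assumes powers: "\<And>A :: 'k^'n^'n. \<exists>N::nat. (map_matrix mpoly_const A ** F) [^]\<^bsub>matrix_ring\<^esub> N
      \<in> right_powers_sum matrix_ring I (map_matrix mpoly_const A ** F) N"
  shows "F \<in> directional_radical I"
proof -
  interpret ring "matrix_ring :: ('k, 'd, 'n) matrix_poly ring" by (rule ring_matrix_ring)
  have "annihilates F a v" if "v \<noteq> 0" and I: "\<forall>G\<in>I. annihilates G a v" for a and v :: "'k^'n"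
  proof (rule ccontr)
    define w where "w = map_matrix (mpoly_eval a) F *v v"
    assume "\<not> annihilates F a v"
    then have "w \<noteq> 0" by (simp add: w_def annihilates_def)
    then obtain A where A: "A *v w = v" by (rule exists_matrix_mapping)
    define B where "B = map_matrix mpoly_const A ** F"
    have B: "map_matrix (mpoly_eval a) B *v v = v"
      using A by (simp add: B_def w_def eval_matrix_mult eval_const_matrix matrix_vector_mul_assoc[symmetric])
    obtain N :: nat where N: "B [^]\<^bsub>matrix_ring\<^esub> N \<in> right_powers_sum matrix_ring I B N"
      using powers[of A] by (auto simp: B_def)
    have "right_powers_sum matrix_ring I B N \<subseteq> point_ideal a v"
    proof (rule right_powers_sum_subset[OF left_ideal_point_ideal])
      show "I \<subseteq> point_ideal a v" using I by (auto simp: point_ideal_def)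
      show "G \<otimes>\<^bsub>matrix_ring\<^esub> B \<in> point_ideal a v" if "G \<in> point_ideal a v" for G
        using that B by (simp add: point_ideal_def annihilates_def eval_matrix_mult matrix_vector_mul_assoc[symmetric])
    qed simp
    with N have "map_matrix (mpoly_eval a) (B [^]\<^bsub>matrix_ring\<^esub> N) *v v = 0"
      by (auto simp: point_ideal_def annihilates_def)
    moreover have "map_matrix (mpoly_eval a) (B [^]\<^bsub>matrix_ring\<^esub> n) *v v = v" for n :: nat
      by (induction n) (simp_all add: B eval_matrix_one eval_matrix_mult matrix_vector_mul_assoc[symmetric])
    ultimately show False using \<open>v \<noteq> 0\<close> by simp
  qed
  then show ?thesis by (simp add: directional_radical_def)
qed

theorem theorem1p4:
  fixes I :: "('k::alg_closed_field, 'd::finite, 'n::finite) matrix_poly set"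
  assumes "left_ideal I matrix_ring"
  shows "directional_radical I =
        {F. \<forall>A :: 'k^'n^'n. \<exists>N::nat.
          (map_matrix mpoly_const A ** F) [^]\<^bsub>matrix_ring\<^esub> N
            \<in> right_powers_sum matrix_ring I (map_matrix mpoly_const A ** F) N} \<and>
      directional_radical I =
        \<Inter>{J. completely_prime_left_ideal J matrix_ring \<and> I \<subseteq> J} \<and>
      directional_radical I =
        \<Inter>{J. prime_left_ideal J matrix_ring \<and> I \<subseteq> J} \<and>
      (semiprime_left_ideal (directional_radical I) matrix_ring \<and>
        I \<subseteq> directional_radical I \<and>
        (\<forall>J. semiprime_left_ideal J matrix_ring \<and> I \<subseteq> J \<longrightarrow> directional_radical I \<subseteq> J))"
proof (intro conjI)
  have 1: "directional_radical I \<subseteq> \<Inter>{J. prime_left_ideal J matrix_ring \<and> I \<subseteq> J}"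
    using directional_radical_subset_semiprime prime_imp_semiprime by blast
  have 2: "\<Inter>{J. prime_left_ideal J matrix_ring \<and> I \<subseteq> J}
      \<subseteq> \<Inter>{J. completely_prime_left_ideal J matrix_ring \<and> I \<subseteq> J}"
    using completely_prime_imp_prime by blast
  have 3: "\<Inter>{J. completely_prime_left_ideal J matrix_ring \<and> I \<subseteq> J} \<subseteq> directional_radical I"
    unfolding directional_radical_eq_Inter using completely_prime_point_ideal by blast
  show "directional_radical I = \<Inter>{J. completely_prime_left_ideal J matrix_ring \<and> I \<subseteq> J}"
    by (rule subset_antisym[OF order_trans[OF 1 2] 3])
  show "directional_radical I = \<Inter>{J. prime_left_ideal J matrix_ring \<and> I \<subseteq> J}"
    by (rule subset_antisym[OF 1 order_trans[OF 2 3]])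
  have "map_matrix mpoly_const A ** F \<in> directional_radical I" if "F \<in> directional_radical I" for A :: "'k^'n^'n" and F
    using left_ideal.I_l_closed[OF left_ideal_directional_radical that] by simp
  then show "directional_radical I = {F. \<forall>A :: 'k^'n^'n. \<exists>N::nat.
      (map_matrix mpoly_const A ** F) [^]\<^bsub>matrix_ring\<^esub> N
        \<in> right_powers_sum matrix_ring I (map_matrix mpoly_const A ** F) N}"
    using directional_radical_powers[OF assms] mem_directional_radical_if_powers[of _ I] by blast
  show "semiprime_left_ideal (directional_radical I) matrix_ring" by (rule semiprime_directional_radical)
  show "I \<subseteq> directional_radical I" by (rule subset_directional_radical)
  show "\<forall>J. semiprime_left_ideal J matrix_ring \<and> I \<subseteq> J \<longrightarrow> directional_radical I \<subseteq> J"
    using directional_radical_subset_semiprime by blast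
qed

end
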